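(* Consider the dynamics, for $t\ge t_0>0$, $i\in\mathcal V_1$, $j\in\mathcal V_2$, $$ \begin{aligned} \dot x_i &= \tfrac rt\big[\nabla\psi_i^*(u_i)-x_i\big], & \dot\lambda_i &= \tfrac rt\big[\gamma_i-\lambda_i\big],\\ \dot u_i &= -\tfrac tr\nabla_{x_i}S\big(\bm x,\bm\lambda+\tfrac tr\dot{\bm\lambda},\bm y+\tfrac tr\dot{\bm y},\bm\mu\big), & \dot\gamma_i &= \tfrac tr\nabla_{\lambda_i}S\big(\bm x+\tfrac tr\dot{\bm x},\bm\lambda,\bm y,\bm\mu\big),\\ \dot y_j &= \tfrac rt\big[\nabla\phi_j^*(v_j)-y_j\big], & \dot\mu_j &= \tfrac rt\big[\nu_j-\mu_j\big],\\ \dot v_j &= \tfrac tr\nabla_{y_j}S\big(\bm x+\tfrac tr\dot{\bm x},\bm\lambda,\bm y,\bm\mu+\tfrac tr\dot{\bm\mu}\big), & \dot\nu_j &= -\tfrac tr\nabla_{\mu_j}S\big(\bm x,\bm\lambda,\bm y+\tfrac tr\dot{\bm y},\bm\mu\big), \end{aligned} $$ with initial conditions $\bm u(t_0)=\bm u_0\in X$, $\bm x(t_0)=\nabla\bm\psi^*(\bm u_0)$, $\bm\gamma(t_0)=\bm\gamma_0\in\mathbb R^{p_1n_1}$, $\bm\lambda(t_0)=\bm\gamma_0$, $\bm v(t_0)=\bm v_0\in Y$, $\bm y(t_0)=\nabla\bm\phi^*(\bm v_0)$, $\bm\nu(t_0)=\bm\nu_0\in\mathbb R^{p_2n_2}$,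 $\bm\mu(t_0)=\bm\nu_0$, and with $r\ge 2$. Let $(\bm x(t),\bm\lambda(t),\bm y(t),\bm\mu(t))$ be a trajectory of these dynamics and let $(\bm x^\star,\bm\lambda^\star,\bm y^\star,\bm\mu^\star)$ be a saddle point of $S$. Suppose Assumptions (A1) and (A2) of the context hold. Then the duality gap $$S\big(\bm x(t),\bm\lambda^\star,\bm y^\star,\bm\mu(t)\big)-S\big(\bm x^\star,\bm\lambda(t),\bm y(t),\bm\mu^\star\big)$$ converges to $0$ with rate $\mathcal O(1/t^2)$. Moreover, $(\bm x(t),\bm y(t))$ approaches $(\bm x^\star,\bm y^\star)$ as $t\to\infty$.
   Context: **Game.** $\mathcal G_1(\mathcal V_1,\mathcal E_1)$ and $\mathcal G_2(\mathcal V_2,\mathcal E_2)$ are connected undirected weighted graphs with $\mathcal V_1=\{1,\dots,n_1\}$, $\mathcal V_2=\{1,\dots,n_2\}$. The weights are symmetric, positive on edges and zero otherwise. Their Laplacians are $\mathcal L_1,\mathcal L_2$ (Laplacian $=$ diagonal degree matrix minus weight matrix). Put $\bm L_1=\mathcal L_1\otimes I_{p_1}$ and $\bm L_2=\mathcal L_2\otimes I_{p_2}$. For $i\in\mathcal V_1$, $j\in\mathcal V_2$, the sets $X_i\subset\mathbb R^{p_1}$ and $Y_j\subset\mathbb R^{p_2}$ are closed and convex; $X=X_1\times\dots\times X_{n_1}$, $Y=Y_1\times\dots\times Y_{n_2}$. Here $\mathrm{col}$ denotes stacking into a column vector, $\bm x=\mathrm{col}\{x_1,\dots,x_{n_1}\}$,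 $\bm y=\mathrm{col}\{y_1,\dots,y_{n_2}\}$, and similarly $\bm\lambda,\bm u,\bm\gamma$ are stacked over $\mathcal V_1$ (blocks in $\mathbb R^{p_1}$) and $\bm\mu,\bm v,\bm\nu$ over $\mathcal V_2$ (blocks in $\mathbb R^{p_2}$). Let $$U(\bm x,\bm y)=\tilde f(\bm x)+\bm x^\top B\bm y-\tilde g(\bm y),\quad \tilde f(\bm x)=\sum_{i\in\mathcal V_1}f_i(x_i),\quad \tilde g(\bm y)=\sum_{j\in\mathcal V_2}g_j(y_j),\quad \bm x^\top B\bm y=\sum_{i\in\mathcal V_1}\sum_{j\in\mathcal V_2}x_i^\top H_{ij}y_j,$$ with $f_i:X_i\to\mathbb R$, $g_j:Y_j\to\mathbb R$, $H_{ij}\in\mathbb R^{p_1\times p_2}$. There is a set $\mathcal E_{\bowtie}\subset\mathcal V_1\times\mathcal V_2$ of edges between the subnetworks, and $H_{ij}\neq \bm 0$ only if $(i,j)\in\mathcal E_{\bowtie}$. The game is $\min_{\bm x\in X}\max_{\bm y\in Y}U(\bm x,\bm y)$ subject to $\bm L_1\bm x=\bm 0$, $\bm L_2\bm y=\bm 0$. A Nash equilibrium (NE) is a feasible $(\bm x^\star,\bm y^\star)$ with $U(\bm x^\star,\bm y)\le U(\bm x^\star,\bm y^\star)\le U(\bm x,\bm y^\star)$ for all feasible $\bm x,\bm y$. **Augmented Lagrangian.** For $\bm x\in X$, $\bm\lambda\in\mathbb R^{p_1n_1}$, $\bm y\in Y$, $\bm\mu\in\mathbb R^{p_2n_2}$,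 $$S(\bm x,\bm\lambda,\bm y,\bm\mu)=U(\bm x,\bm y)+\bm\lambda^\top\bm L_1\bm x-\bm\mu^\top\bm L_2\bm y+\tfrac12\bm x^\top\bm L_1\bm x-\tfrac12\bm y^\top\bm L_2\bm y.$$ It is minimized over $(\bm x,\bm\mu)$ and maximized over $(\bm y,\bm\lambda)$: $(\bm x^\star,\bm\lambda^\star,\bm y^\star,\bm\mu^\star)$ is a saddle point of $S$ if $S(\bm x^\star,\bm\lambda,\bm y,\bm\mu^\star)\le S(\bm x^\star,\bm\lambda^\star,\bm y^\star,\bm\mu^\star)\le S(\bm x,\bm\lambda^\star,\bm y^\star,\bm\mu)$ for all $\bm x\in X$, $\bm y\in Y$, $\bm\lambda$, $\bm\mu$. **Generating functions.** $\psi_i:X_i\to\mathbb R$, $\phi_j:Y_j\to\mathbb R$, with convex conjugates $\psi_i^*(u)=\sup_{x\in X_i}\{x^\top u-\psi_i(x)\}$ and $\phi_j^*(v)=\sup_{y\in Y_j}\{y^\top v-\phi_j(y)\}$. For strongly convex $\psi_i$, $\nabla\psi_i^*(u)=\mathrm{argmin}_{x\in X_i}\{-x^\top u+\psi_i(x)\}$, and similarly for $\phi_j$. Put $\nabla\bm\psi^*(\bm u)=\mathrm{col}\{\nabla\psi_1^*(u_1),\dots,\nabla\psi_{n_1}^*(u_{n_1})\}$ and $\nabla\bm\phi^*(\bm v)=\mathrm{col}\{\nabla\phi_1^*(v_1),\dots,\nabla\phi_{n_2}^*(v_{n_2})\}$. **Assumption (A1).** $f_i$ and $g_j$ are continuously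 differentiable and strictly convex on $X_i$ and $Y_j$, respectively; their gradients are Lipschitz continuous over $X_i$ and $Y_j$; Slater's constraint qualification holds (there are points in the relative interiors of $X$ and $Y$ satisfying $\bm L_1\bm x=\bm 0$ and $\bm L_2\bm y=\bm 0$); and the NE lies in the relative interior of $X\times Y$. **Assumption (A2).** $\psi_i$ and $\phi_j$ are continuously differentiable with Lipschitz continuous gradients, and strongly convex. Besides, $\nabla\psi_i^*$ and $\nabla\phi_j^*$ are Lipschitz continuous over $X_i$ and $Y_j$. *)

theory Defs
  imports "HOL-Analysis.Analysis"
begin

(* Stacked vectors col{x_1, ..., x_n} with blocks in R^p are elements of (real ^ 'p) ^ 'n;
   the inner product of this type is the inner product of the stacked vectors. *)

definition block_product :: "('n \<Rightarrow> 'a set) \<Rightarrow> ('a ^ 'n) set" where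
  "block_product C = {x. \<forall>i. x $ i \<in> C i}"

definition block_upd :: "'a ^ 'n \<Rightarrow> 'n \<Rightarrow> 'a \<Rightarrow> 'a ^ 'n" where
  "block_upd x i z = (\<chi> k. if k = i then z else x $ k)"


section \<open>Weighted graphs and Laplacians\<close>

(* The vertex set is the whole index type. An undirected edge {i, k} is the pair of ordered
   pairs (i, k), (k, i). Loops are not excluded: they cancel in the Laplacian. *)

definition connected_weighted_graph :: "('n::finite \<times> 'n) set \<Rightarrow> real ^ 'n ^ 'n \<Rightarrow> bool" where
  "connected_weighted_graph E w \<longleftrightarrow>
     sym E \<and> transpose w = w \<and>
     (\<forall>i k. ((i, k) \<in> E \<longrightarrow> w $ i $ k > 0) \<and> ((i, k) \<notin> E \<longrightarrow> w $ i $ k = 0)) \<and>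
     (\<forall>i k. (i, k) \<in> E\<^sup>*)"

definition laplacian :: "real ^ 'n ^ 'n \<Rightarrow> real ^ 'n ^ 'n::finite" where
  "laplacian w = (\<chi> i k. (if i = k then (\<Sum>l\<in>UNIV. w $ i $ l) else 0) - w $ i $ k)"

(* (A \<otimes> I_p) x for a stacked vector x: the (i, k) block of A \<otimes> I_p is A_ik I_p. *)

definition kron_id_mult :: "real ^ 'n ^ 'n \<Rightarrow> (real ^ 'p) ^ 'n \<Rightarrow> (real ^ 'p) ^ 'n::finite" where
  "kron_id_mult A x = (\<chi> i. \<Sum>k\<in>UNIV. A $ i $ k *\<^sub>R x $ k)"


section \<open>Gradients, convexity and conjugates\<close>

(* Functions given on a closed convex set C, possibly with empty interior, are differentiated
   within C. If C has nonempty interior, the gradient within C is unique at each point of C;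
   otherwise only its component along the affine hull of C is determined. *)

definition has_gradient_within :: "('a::real_inner \<Rightarrow> real) \<Rightarrow> 'a \<Rightarrow> 'a \<Rightarrow> 'a set \<Rightarrow> bool" where
  "has_gradient_within f D x C \<longleftrightarrow> (f has_derivative (\<lambda>h. h \<bullet> D)) (at x within C)"

(* D is the partial gradient of F in the i-th block at the point x, taken within C. *)

definition has_block_gradient ::
    "('a::real_inner ^ 'n \<Rightarrow> real) \<Rightarrow> 'n \<Rightarrow> 'a set \<Rightarrow> 'a ^ 'n \<Rightarrow> 'a \<Rightarrow> bool" where
  "has_block_gradient F i C x D \<longleftrightarrow>
     has_gradient_within (\<lambda>z. F (block_upd x i z)) D (x $ i) C"

definition C1_lipschitz_gradient_on :: "'a::real_inner set \<Rightarrow> ('a \<Rightarrow> real) \<Rightarrow> bool" where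
  "C1_lipschitz_gradient_on C f \<longleftrightarrow>
     (\<exists>G. (\<forall>x\<in>C. has_gradient_within f (G x) x C) \<and> continuous_on C G \<and>
          (\<exists>K. K-lipschitz_on C G))"

definition strictly_convex_on :: "'a::real_vector set \<Rightarrow> ('a \<Rightarrow> real) \<Rightarrow> bool" where
  "strictly_convex_on C f \<longleftrightarrow>
     convex C \<and>
     (\<forall>x\<in>C. \<forall>y\<in>C. \<forall>s. x \<noteq> y \<and> 0 < s \<and> s < 1 \<longrightarrow>
        f (s *\<^sub>R x + (1 - s) *\<^sub>R y) < s * f x + (1 - s) * f y)"

definition strongly_convex_on :: "'a::real_normed_vector set \<Rightarrow> ('a \<Rightarrow> real) \<Rightarrow> bool" where
  "strongly_convex_on C f \<longleftrightarrow>
     convex C \<and>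
     (\<exists>c>0. \<forall>x\<in>C. \<forall>y\<in>C. \<forall>s. 0 \<le> s \<and> s \<le> 1 \<longrightarrow>
        f (s *\<^sub>R x + (1 - s) *\<^sub>R y)
          \<le> s * f x + (1 - s) * f y - c / 2 * s * (1 - s) * (norm (x - y))\<^sup>2)"

(* The real supremum is meaningful only where the set is bounded above, which is the case for
   all u if f is continuous and strongly convex on a nonempty closed set C. *)

definition conjugate_on :: "'a::real_inner set \<Rightarrow> ('a \<Rightarrow> real) \<Rightarrow> 'a \<Rightarrow> real" where
  "conjugate_on C f u = (SUP x\<in>C. x \<bullet> u - f x)"

definition gradient :: "('a::real_inner \<Rightarrow> real) \<Rightarrow> 'a \<Rightarrow> 'a" where
  "gradient f u = (THE D. GDERIV f u :> D)"


section \<open>The game and its augmented Lagrangian\<close>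

definition payoff ::
    "('n1::finite \<Rightarrow> real ^ 'p1 \<Rightarrow> real) \<Rightarrow> ('n2::finite \<Rightarrow> real ^ 'p2 \<Rightarrow> real) \<Rightarrow>
     ('n1 \<Rightarrow> 'n2 \<Rightarrow> real ^ 'p2 ^ 'p1) \<Rightarrow> (real ^ 'p1) ^ 'n1 \<Rightarrow> (real ^ 'p2) ^ 'n2 \<Rightarrow> real" where
  "payoff f g H x y =
     (\<Sum>i\<in>UNIV. f i (x $ i))
     + (\<Sum>i\<in>UNIV. \<Sum>j\<in>UNIV. x $ i \<bullet> (H i j *v y $ j))
     - (\<Sum>j\<in>UNIV. g j (y $ j))"

definition feasible ::
    "('n \<Rightarrow> (real ^ 'p) set) \<Rightarrow> real ^ 'n ^ 'n \<Rightarrow> ((real ^ 'p) ^ 'n::finite) set" where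
  "feasible C w = {x \<in> block_product C. kron_id_mult (laplacian w) x = 0}"

definition nash_equilibrium ::
    "('a \<Rightarrow> 'b \<Rightarrow> real) \<Rightarrow> 'a set \<Rightarrow> 'b set \<Rightarrow> 'a \<Rightarrow> 'b \<Rightarrow> bool" where
  "nash_equilibrium U A B xs ys \<longleftrightarrow>
     xs \<in> A \<and> ys \<in> B \<and> (\<forall>x\<in>A. \<forall>y\<in>B. U xs y \<le> U xs ys \<and> U xs ys \<le> U x ys)"

definition augmented_lagrangian ::
    "((real ^ 'p1) ^ 'n1 \<Rightarrow> (real ^ 'p2) ^ 'n2 \<Rightarrow> real) \<Rightarrow>
     real ^ 'n1 ^ 'n1::finite \<Rightarrow> real ^ 'n2 ^ 'n2::finite \<Rightarrow>
     (real ^ 'p1) ^ 'n1 \<Rightarrow> (real ^ 'p1) ^ 'n1 \<Rightarrow> (real ^ 'p2) ^ 'n2 \<Rightarrow> (real ^ 'p2) ^ 'n2 \<Rightarrow> real" where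
  "augmented_lagrangian U w1 w2 x l y m =
     U x y
     + l \<bullet> kron_id_mult (laplacian w1) x
     - m \<bullet> kron_id_mult (laplacian w2) y
     + 1/2 * (x \<bullet> kron_id_mult (laplacian w1) x)
     - 1/2 * (y \<bullet> kron_id_mult (laplacian w2) y)"

definition saddle_point ::
    "('a \<Rightarrow> 'c \<Rightarrow> 'b \<Rightarrow> 'd \<Rightarrow> real) \<Rightarrow> 'a set \<Rightarrow> 'b set \<Rightarrow> 'a \<Rightarrow> 'c \<Rightarrow> 'b \<Rightarrow> 'd \<Rightarrow> bool" where
  "saddle_point S A B xs ls ys ms \<longleftrightarrow>
     xs \<in> A \<and> ys \<in> B \<and>
     (\<forall>x\<in>A. \<forall>y\<in>B. \<forall>l m. S xs l y ms \<le> S xs ls ys ms \<and> S xs ls ys ms \<le> S x ls ys m)"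


section \<open>The dynamics\<close>

(* Time derivatives on [t0, \<infinity>), one-sided at t0. *)

abbreviation dot :: "real \<Rightarrow> (real \<Rightarrow> 'a::real_normed_vector) \<Rightarrow> real \<Rightarrow> 'a" where
  "dot t0 z t \<equiv> vector_derivative z (at t within {t0..})"

(* The state is (x, l, u, c, y, m, v, n), where l, c, m, n stand for lambda, gamma, mu, nu.
   The gradients of S in x_i and y_j are taken within X_i and Y_j; where such a gradient is not
   unique, every choice is admitted. *)

definition trajectory ::
    "((real ^ 'p1) ^ 'n1 \<Rightarrow> (real ^ 'p1) ^ 'n1 \<Rightarrow> (real ^ 'p2) ^ 'n2 \<Rightarrow> (real ^ 'p2) ^ 'n2 \<Rightarrow> real) \<Rightarrow>
     ('n1::finite \<Rightarrow> (real ^ 'p1) set) \<Rightarrow> ('n2::finite \<Rightarrow> (real ^ 'p2) set) \<Rightarrow>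
     ('n1 \<Rightarrow> real ^ 'p1 \<Rightarrow> real) \<Rightarrow> ('n2 \<Rightarrow> real ^ 'p2 \<Rightarrow> real) \<Rightarrow> real \<Rightarrow> real \<Rightarrow>
     (real \<Rightarrow> (real ^ 'p1) ^ 'n1) \<Rightarrow> (real \<Rightarrow> (real ^ 'p1) ^ 'n1) \<Rightarrow>
     (real \<Rightarrow> (real ^ 'p1) ^ 'n1) \<Rightarrow> (real \<Rightarrow> (real ^ 'p1) ^ 'n1) \<Rightarrow>
     (real \<Rightarrow> (real ^ 'p2) ^ 'n2) \<Rightarrow> (real \<Rightarrow> (real ^ 'p2) ^ 'n2) \<Rightarrow>
     (real \<Rightarrow> (real ^ 'p2) ^ 'n2) \<Rightarrow> (real \<Rightarrow> (real ^ 'p2) ^ 'n2) \<Rightarrow> bool" where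
  "trajectory S X Y \<psi> \<phi> r t0 x l u c y m v n \<longleftrightarrow>
     (\<forall>t\<ge>t0.
        (\<forall>i.
          ((\<lambda>s. x s $ i) has_vector_derivative
             (r / t) *\<^sub>R (gradient (conjugate_on (X i) (\<psi> i)) (u t $ i) - x t $ i))
             (at t within {t0..}) \<and>
          ((\<lambda>s. l s $ i) has_vector_derivative (r / t) *\<^sub>R (c t $ i - l t $ i))
             (at t within {t0..}) \<and>
          (\<exists>D. has_block_gradient
                 (\<lambda>z. S z (l t + (t / r) *\<^sub>R dot t0 l t) (y t + (t / r) *\<^sub>R dot t0 y t) (m t))
                 i (X i) (x t) D \<and>
               ((\<lambda>s. u s $ i) has_vector_derivative - ((t / r) *\<^sub>R D)) (at t within {t0..})) \<and>
          (\<exists>D. has_block_gradient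
                 (\<lambda>z. S (x t + (t / r) *\<^sub>R dot t0 x t) z (y t) (m t)) i UNIV (l t) D \<and>
               ((\<lambda>s. c s $ i) has_vector_derivative (t / r) *\<^sub>R D) (at t within {t0..}))) \<and>
        (\<forall>j.
          ((\<lambda>s. y s $ j) has_vector_derivative
             (r / t) *\<^sub>R (gradient (conjugate_on (Y j) (\<phi> j)) (v t $ j) - y t $ j))
             (at t within {t0..}) \<and>
          ((\<lambda>s. m s $ j) has_vector_derivative (r / t) *\<^sub>R (n t $ j - m t $ j))
             (at t within {t0..}) \<and>
          (\<exists>D. has_block_gradient
                 (\<lambda>z. S (x t + (t / r) *\<^sub>R dot t0 x t) (l t) z (m t + (t / r) *\<^sub>R dot t0 m t))
                 j (Y j) (y t) D \<and>
               ((\<lambda>s. v s $ j) has_vector_derivative (t / r) *\<^sub>R D) (at t within {t0..})) \<and>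
          (\<exists>D. has_block_gradient
                 (\<lambda>z. S (x t) (l t) (y t + (t / r) *\<^sub>R dot t0 y t) z) j UNIV (m t) D \<and>
               ((\<lambda>s. n s $ j) has_vector_derivative - ((t / r) *\<^sub>R D)) (at t within {t0..})))) \<and>
     u t0 \<in> block_product X \<and>
     (\<forall>i. x t0 $ i = gradient (conjugate_on (X i) (\<psi> i)) (u t0 $ i)) \<and>
     l t0 = c t0 \<and>
     v t0 \<in> block_product Y \<and>
     (\<forall>j. y t0 $ j = gradient (conjugate_on (Y j) (\<phi> j)) (v t0 $ j)) \<and>
     m t0 = n t0"

end

theory Submission
  imports Defs
begin

text \<open>
  Let \<open>L\<^sub>1\<close>, \<open>L\<^sub>2\<close> be the Laplacians acting on stacked vectors and \<open>B\<close> the coupling matrix.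
  The multipliers of a saddle point certify feasibility: \<open>S xs l ys ms \<le> S xs ls ys ms\<close> for all
  \<open>l\<close> forces \<open>L\<^sub>1 xs = 0\<close>, and likewise \<open>L\<^sub>2 ys = 0\<close>. As a consequence the duality gap does not depend on
  the multipliers of the trajectory, and it splits into two parts
  \<open>[\<Phi>\<^sub>1 (x t) - \<Phi>\<^sub>1 xs] + [\<Phi>\<^sub>2 (y t) - \<Phi>\<^sub>2 ys]\<close>, where
  \<open>\<Phi>\<^sub>1 = f + \<langle>\<cdot>, B ys + L\<^sub>1 ls\<rangle> + \<langle>\<cdot>, L\<^sub>1 \<cdot>\<rangle>/2\<close> and \<open>\<Phi>\<^sub>2 = g + \<langle>\<cdot>, L\<^sub>2 ms - B\<^sup>T xs\<rangle> + \<langle>\<cdot>, L\<^sub>2 \<cdot>\<rangle>/2\<close>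
  are strictly convex and are minimized at \<open>xs\<close> and \<open>ys\<close>.

  The extrapolated states are the mirror points, \<open>x + (t/r) x' = p = \<nabla>\<psi>\<^sup>*(u)\<close> and
  \<open>y + (t/r) y' = q = \<nabla>\<phi>\<^sup>*(v)\<close>, and the extrapolated multipliers are \<open>c\<close> and \<open>n\<close>. With this the
  dynamics become two copies of one system, which the locale \<open>player\<close> describes: a player with own
  cost \<open>\<Phi>\<close> is driven by a signal \<open>e\<close> (\<open>B q\<close> for the minimizer, \<open>-B\<^sup>T p\<close> for the maximizer) whose
  value at the saddle point is \<open>es\<close>. For each player the energy
  \<open>(t/r)\<^sup>2 (\<Phi> (z t) - \<Phi> zs) + \<Sum>\<^sub>i [\<psi>\<^sub>i\<^sup>*(u\<^sub>i) + \<psi>\<^sub>i(zs\<^sub>i) - \<langle>zs\<^sub>i, u\<^sub>i\<rangle>] + \<parallel>c - ls\<parallel>\<^sup>2/2\<close>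
  has nonnegative terms. The factor \<open>(t/r)\<^sup>2\<close> is matched to the step sizes \<open>r/t\<close> and \<open>t/r\<close> so that
  the terms of its derivative that have no sign cancel, up to the exchange term
  \<open>-(t/r) \<langle>p - zs, e - es\<rangle>\<close>. By convexity the rest is at most \<open>2t/r\<^sup>2 - t/r\<close> times the nonnegative cost
  gap, and this factor is nonpositive for \<open>r \<ge> 2\<close> (lemma \<open>energy_deriv\<close>). The exchange terms of the
  two players are opposite because their signals are adjoint to each other. Hence the total energy does
  not increase, and \<open>(t/r)\<^sup>2 \<cdot> gap\<close> stays below the initial total energy.

  Both parts of the gap are nonnegative, so both tend to \<open>0\<close>; a strictly convex function on a closed
  convex set of finite dimension whose values approach the minimum has its arguments approach the
  minimizer (lemma \<open>strict_minimizer_attracts\<close>).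

  Two facts make the energy meaningful. The conjugate of a strongly convex function is differentiable
  with the maximizing point as its gradient (lemma \<open>gradient_conjugate\<close>), so the mirror points lie in
  the constraint sets. The state is a weighted time average of its initial value and the mirror points,
  hence it never leaves the constraint sets (lemma \<open>relaxation_stays_in_convex_set\<close>). Gradients within
  the constraint sets may be non-unique, but only their pairing with differences of points of the sets
  matters, and this is controlled by the convexity inequality for whichever gradient the trajectory
  follows.
\<close>

section \<open>Gradients within a convex set\<close>

text \<open>
  The first-order inequality with modulus \<open>k\<close>, for any gradient within \<open>C\<close>: the difference quotients
  along the segment from \<open>x\<close> to \<open>y\<close>, which converge from the right to \<open>(y - x) \<bullet> D\<close>, are bounded by
  convexity. The case \<open>k = 0\<close> serves the costs, \<open>k > 0\<close> the generating functions.
\<close>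

lemma convex_gradient_inequality:
  fixes f :: "'a::real_inner \<Rightarrow> real"
  assumes grad: "has_gradient_within f D x C"
    and C: "convex C" "x \<in> C" "y \<in> C"
    and conv: "\<And>s. 0 < s \<Longrightarrow> s < 1 \<Longrightarrow>
      f (s *\<^sub>R y + (1 - s) *\<^sub>R x) \<le> s * f y + (1 - s) * f x - k / 2 * s * (1 - s) * (norm (y - x))\<^sup>2"
  shows "f x + (y - x) \<bullet> D + k / 2 * (norm (y - x))\<^sup>2 \<le> f y"
proof -
  let ?p = "\<lambda>s::real. s *\<^sub>R y + (1 - s) *\<^sub>R x"
  have sub: "?p ` {0..1} \<subseteq> C"
    using convexD[OF C(1,3,2)] by auto
  have dp: "(?p has_derivative (\<lambda>s. s *\<^sub>R (y - x))) (at 0 within {0..1})"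
    by (auto intro!: derivative_eq_intros simp: algebra_simps)
  have df: "(f has_derivative (\<lambda>h. h \<bullet> D)) (at (?p 0) within ?p ` {0..1})"
    using grad has_derivative_subset[OF _ sub] by (simp add: has_gradient_within_def)
  have "((\<lambda>s. f (?p s)) has_derivative (\<lambda>s. (s *\<^sub>R (y - x)) \<bullet> D)) (at 0 within {0..1})"
    by (rule has_derivative_in_compose[OF dp df])
  then have "((\<lambda>s. f (?p s)) has_real_derivative (y - x) \<bullet> D) (at 0 within {0..1})"
    by (simp add: has_field_derivative_def mult_commute_abs)
  then have "((\<lambda>s. (f (?p s) - f (?p 0)) / (s - 0)) \<longlongrightarrow> (y - x) \<bullet> D) (at 0 within {0..1})"
    by (simp only: has_field_derivative_iff)
  then have lim: "((\<lambda>s. (f (?p s) - f x) / s) \<longlongrightarrow> (y - x) \<bullet> D) (at_right 0)"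
    by (simp add: at_within_Icc_at_right)
  have lim2: "((\<lambda>s. f y - f x - k / 2 * (1 - s) * (norm (y - x))\<^sup>2)
      \<longlongrightarrow> f y - f x - k / 2 * (1 - 0) * (norm (y - x))\<^sup>2) (at_right 0)"
    by (intro tendsto_intros)
  have "eventually (\<lambda>s. s \<in> {0<..<1}) (at_right (0::real))"
    by (rule eventually_at_rightI[of 0 1]) auto
  then have "eventually (\<lambda>s. (f (?p s) - f x) / s \<le> f y - f x - k / 2 * (1 - s) * (norm (y - x))\<^sup>2)
      (at_right 0)"
  proof eventually_elim
    case (elim s)
    then have "f (?p s) - f x \<le> s * (f y - f x - k / 2 * (1 - s) * (norm (y - x))\<^sup>2)"
      using conv[of s] by (simp add: algebra_simps)
    with elim show ?case
      by (simp add: divide_le_eq mult.commute)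
  qed
  from tendsto_le[OF _ lim2 lim this] show ?thesis
    by simp
qed

lemma strictly_convex_gradient_inequality:
  assumes "has_gradient_within f D x C" "strictly_convex_on C f" "x \<in> C" "y \<in> C"
  shows "f x + (y - x) \<bullet> D \<le> f y"
proof (cases "x = y")
  case False
  have "f x + (y - x) \<bullet> D + 0 / 2 * (norm (y - x))\<^sup>2 \<le> f y"
  proof (rule convex_gradient_inequality[OF assms(1) _ assms(3,4)])
    show "convex C" using assms(2) by (simp add: strictly_convex_on_def)
    show "f (s *\<^sub>R y + (1 - s) *\<^sub>R x) \<le> s * f y + (1 - s) * f x - 0 / 2 * s * (1 - s) * (norm (y - x))\<^sup>2"
      if "0 < s" "s < 1" for s
      using assms(2)[unfolded strictly_convex_on_def, THEN conjunct2, rule_format, OF assms(4,3), of s]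
        that False by simp
  qed
  then show ?thesis by simp
qed simp

lemma continuous_on_C1:
  assumes "C1_lipschitz_gradient_on C f"
  shows "continuous_on C f"
proof -
  obtain G where "\<And>x. x \<in> C \<Longrightarrow> has_gradient_within f (G x) x C"
    using assms unfolding C1_lipschitz_gradient_on_def by blast
  then show ?thesis
    unfolding has_gradient_within_def by (rule has_derivative_continuous_on)
qed

lemma has_real_derivative_along_curve:
  fixes z :: "real \<Rightarrow> 'a::real_inner"
  assumes "has_gradient_within f D (z t) C"
    and "(z has_vector_derivative d) (at t within T)" "z ` T \<subseteq> C"
  shows "((\<lambda>s. f (z s)) has_real_derivative d \<bullet> D) (at t within T)"
proof -
  have "(f has_derivative (\<lambda>h. h \<bullet> D)) (at (z t) within z ` T)"
    using assms(1,3) has_derivative_subset by (auto simp: has_gradient_within_def)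
  from has_derivative_in_compose[OF assms(2)[unfolded has_vector_derivative_def] this]
  show ?thesis
    by (simp add: has_field_derivative_def mult_commute_abs)
qed


section \<open>The conjugate of a strongly convex function\<close>

text \<open>
  Strong convexity together with one gradient makes \<open>\<psi> - \<langle>\<cdot>, u\<rangle>\<close> grow quadratically away from any
  point of \<open>C\<close>, so a minimum over a large ball is a global one. Comparing the minimum with the value at
  the midpoint of \<open>x\<close> and \<open>p\<close> yields the quadratic growth at \<open>p\<close>.
\<close>

lemma strongly_convex_attains_minimum:
  fixes \<psi> :: "'a::euclidean_space \<Rightarrow> real"
  assumes C: "closed C" "C \<noteq> {}"
    and C1: "C1_lipschitz_gradient_on C \<psi>" and sc: "strongly_convex_on C \<psi>"
  obtains p k where "p \<in> C" "k > 0"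
    "\<And>x. x \<in> C \<Longrightarrow> \<psi> p - p \<bullet> u + k * (norm (x - p))\<^sup>2 \<le> \<psi> x - x \<bullet> u"
proof -
  obtain x0 where x0: "x0 \<in> C" using C by auto
  obtain G where G: "has_gradient_within \<psi> G x0 C"
    using C1 x0 unfolding C1_lipschitz_gradient_on_def by metis
  obtain k where k: "k > 0" and kc: "\<And>x y s. x \<in> C \<Longrightarrow> y \<in> C \<Longrightarrow> 0 \<le> s \<Longrightarrow> s \<le> 1 \<Longrightarrow>
        \<psi> (s *\<^sub>R x + (1 - s) *\<^sub>R y) \<le> s * \<psi> x + (1 - s) * \<psi> y - k / 2 * s * (1 - s) * (norm (x - y))\<^sup>2"
    using sc unfolding strongly_convex_on_def by blast
  have cvx: "convex C" using sc by (simp add: strongly_convex_on_def)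
  let ?h = "\<lambda>x. \<psi> x - x \<bullet> u"
  \<comment> \<open>Beyond this radius the quadratic term of the first-order inequality dominates the linear one.\<close>
  define R where "R = 2 * norm (G - u) / k"
  have far: "?h x0 \<le> ?h x" if x: "x \<in> C" and "norm (x - x0) \<ge> R" for x
  proof -
    have "\<psi> x0 + (x - x0) \<bullet> G + k / 2 * (norm (x - x0))\<^sup>2 \<le> \<psi> x"
      using kc[OF x x0] by (intro convex_gradient_inequality[OF G cvx x0 x]) simp
    moreover have "- (norm (x - x0) * norm (G - u)) \<le> (x - x0) \<bullet> (G - u)"
      using Cauchy_Schwarz_ineq2[of "x - x0" "G - u"] by linarith
    moreover have "norm (x - x0) * norm (G - u) \<le> norm (x - x0) * (k / 2 * norm (x - x0))"
      using that k by (intro mult_left_mono) (auto simp: R_def field_simps)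
    ultimately show ?thesis
      by (simp add: inner_diff power2_eq_square algebra_simps)
  qed
  have "compact (C \<inter> cball x0 R)" "x0 \<in> C \<inter> cball x0 R"
    using C x0 k by (auto simp: closed_Int_compact R_def)
  moreover have "continuous_on (C \<inter> cball x0 R) ?h"
    by (intro continuous_intros continuous_on_subset[OF continuous_on_C1[OF C1]]) auto
  ultimately obtain p where p: "p \<in> C" "\<And>x. x \<in> C \<inter> cball x0 R \<Longrightarrow> ?h p \<le> ?h x"
    using continuous_attains_inf[of "C \<inter> cball x0 R" ?h] by blast
  have min: "?h p \<le> ?h x" if "x \<in> C" for x
  proof (cases "norm (x - x0) \<le> R")
    case True
    then show ?thesis using p that by (simp add: dist_norm norm_minus_commute)
  next
    case False
    then show ?thesis
      using far[of x] p(2)[OF \<open>x0 \<in> C \<inter> cball x0 R\<close>] that by simp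
  qed
  show ?thesis
  proof (rule that[OF p(1), of "k / 4"])
    fix x assume x: "x \<in> C"
    let ?w = "(1/2) *\<^sub>R x + (1 - 1/2) *\<^sub>R p"
    have "?w \<in> C" using convexD[OF cvx x p(1), of "1/2" "1/2"] by simp
    from min[OF this] kc[OF x p(1), of "1/2"]
    show "?h p + k / 4 * (norm (x - p))\<^sup>2 \<le> ?h x"
      by (simp add: inner_left_distrib)
  qed (use k in simp)
qed

text \<open>
  The maximizer \<open>p\<close> of \<open>x \<bullet> u - \<psi> x\<close> is the gradient of the conjugate at \<open>u\<close>: the affine function
  \<open>v \<mapsto> p \<bullet> v - \<psi> p\<close> supports the conjugate from below at \<open>u\<close>, and by the quadratic growth of
  \<open>\<psi> - \<langle>\<cdot>, u\<rangle>\<close> at \<open>p\<close> the conjugate exceeds it by at most a multiple of \<open>\<parallel>v - u\<parallel>\<^sup>2\<close>. The third claim is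
  the Fenchel-Young inequality.
\<close>

lemma gradient_conjugate:
  fixes \<psi> :: "'a::euclidean_space \<Rightarrow> real"
  assumes C: "closed C" "C \<noteq> {}"
    and C1: "C1_lipschitz_gradient_on C \<psi>" and sc: "strongly_convex_on C \<psi>"
  shows "gradient (conjugate_on C \<psi>) u \<in> C" (is "?in")
    and "GDERIV (conjugate_on C \<psi>) u :> gradient (conjugate_on C \<psi>) u" (is "?deriv")
    and "x \<in> C \<Longrightarrow> x \<bullet> u - \<psi> x \<le> conjugate_on C \<psi> u"
proof -
  let ?g = "conjugate_on C \<psi>"
  have bdd: "bdd_above ((\<lambda>x. x \<bullet> v - \<psi> x) ` C)" for v
  proof -
    obtain p k where "k > 0" and
      pk: "\<And>x. x \<in> C \<Longrightarrow> \<psi> p - p \<bullet> v + k * (norm (x - p))\<^sup>2 \<le> \<psi> x - x \<bullet> v"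
      using strongly_convex_attains_minimum[OF assms] by metis
    show ?thesis
    proof (rule bdd_aboveI2)
      fix x assume "x \<in> C"
      have "0 \<le> k * (norm (x - p))\<^sup>2" using \<open>k > 0\<close> by simp
      with pk[OF \<open>x \<in> C\<close>] show "x \<bullet> v - \<psi> x \<le> p \<bullet> v - \<psi> p" by linarith
    qed
  qed
  have fenchel: "x \<bullet> v - \<psi> x \<le> ?g v" if "x \<in> C" for x v
    unfolding conjugate_on_def using cSUP_upper[OF that bdd] .
  then show "x \<in> C \<Longrightarrow> x \<bullet> u - \<psi> x \<le> conjugate_on C \<psi> u" by blast
  obtain p k where p: "p \<in> C" "k > 0" and
    pk: "\<And>x. x \<in> C \<Longrightarrow> \<psi> p - p \<bullet> u + k * (norm (x - p))\<^sup>2 \<le> \<psi> x - x \<bullet> u"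
    using strongly_convex_attains_minimum[OF assms] by metis
  have upper: "?g v \<le> p \<bullet> u - \<psi> p + p \<bullet> (v - u) + (norm (v - u))\<^sup>2 / k" for v
    unfolding conjugate_on_def
  proof (rule cSUP_least[OF C(2)])
    fix x assume x: "x \<in> C"
    have square: "(norm (k *\<^sub>R a - (1/2) *\<^sub>R b))\<^sup>2 = k * (k * (norm a)\<^sup>2 - a \<bullet> b) + (norm b)\<^sup>2 / 4"
      for a b :: 'a
      unfolding power2_norm_eq_inner
      by (simp add: inner_diff_left inner_diff_right inner_commute[of b a] algebra_simps)
    have "0 \<le> (norm (k *\<^sub>R (x - p) - (1/2) *\<^sub>R (v - u)))\<^sup>2" by simp
    then have "(x - p) \<bullet> (v - u) - k * (norm (x - p))\<^sup>2 \<le> (norm (v - u))\<^sup>2 / (4 * k)"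
      unfolding square using \<open>k > 0\<close> by (simp add: divide_simps mult_ac distrib_left) (simp add: algebra_simps)
    also have "\<dots> \<le> (norm (v - u))\<^sup>2 / k"
      using \<open>k > 0\<close> by (simp add: field_simps)
    finally show "x \<bullet> v - \<psi> x \<le> p \<bullet> u - \<psi> p + p \<bullet> (v - u) + (norm (v - u))\<^sup>2 / k"
      using pk[OF x] by (simp add: inner_diff)
  qed
  have gu: "?g u = p \<bullet> u - \<psi> p"
    using upper[of u] fenchel[OF p(1), of u] by simp
  have remainder: "norm (?g v - ?g u - (v - u) \<bullet> p) \<le> norm (v - u) / k * norm (v - u)" for v
    using upper[of v] fenchel[OF p(1), of v] gu
    by (simp add: inner_diff inner_commute power2_eq_square)
  have deriv: "GDERIV ?g u :> p"
    unfolding gderiv_def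
  proof (rule has_derivativeI_sandwich[of 1])
    show "bounded_linear (\<lambda>h. h \<bullet> p)" by (rule bounded_linear_inner_left)
    show "((\<lambda>v. norm (v - u) / k) \<longlongrightarrow> 0) (at u)"
      using p(2) by (auto intro!: tendsto_eq_intros)
    show "norm (?g v - ?g u - (v - u) \<bullet> p) / norm (v - u) \<le> norm (v - u) / k" if "v \<noteq> u" for v
      using remainder[of v] that by (simp add: divide_le_eq)
  qed simp
  have "gradient ?g u = p"
    unfolding gradient_def
  proof (rule the_equality[where P = "\<lambda>D. GDERIV ?g u :> D", OF deriv])
    fix D assume "GDERIV ?g u :> D"
    then have "(\<lambda>h. h \<bullet> D) = (\<lambda>h. h \<bullet> p)"
      using deriv has_derivative_unique by (auto simp: gderiv_def)
    then have "(D - p) \<bullet> D = (D - p) \<bullet> p" by (rule fun_cong)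
    then show "D = p"
      by (metis inner_diff_right inner_eq_zero_iff right_minus_eq)
  qed
  with p deriv show ?in ?deriv by simp_all
qed


section \<open>Strict minimizers\<close>

text \<open>
  On the compact intersection of \<open>C\<close> with a sphere around \<open>zs\<close> the function exceeds its minimum by a
  fixed amount. Convexity along segments to \<open>zs\<close> carries this bound to all points of \<open>C\<close> outside the
  sphere, so values close to the minimum are only taken inside.
\<close>

lemma strict_minimizer_attracts:
  fixes zs :: "'a::euclidean_space"
  assumes C: "closed C" "convex C" "zs \<in> C" and cont: "continuous_on C h"
    and min: "\<And>z. z \<in> C \<Longrightarrow> h zs \<le> h z"
    and strict: "\<And>z s. z \<in> C \<Longrightarrow> z \<noteq> zs \<Longrightarrow> 0 < s \<Longrightarrow> s < 1 \<Longrightarrow>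
        h (s *\<^sub>R z + (1 - s) *\<^sub>R zs) < s * h z + (1 - s) * h zs"
    and zC: "eventually (\<lambda>t. z t \<in> C) F"
    and lim: "((\<lambda>t. h (z t)) \<longlongrightarrow> h zs) F"
  shows "(z \<longlongrightarrow> zs) F"
proof (rule tendstoI)
  fix e :: real assume e: "e > 0"
  let ?K = "C \<inter> sphere zs e"
  have seg: "\<exists>w\<in>?K. h w \<le> h x" if x: "x \<in> C" and d: "e \<le> dist x zs" for x
  proof -
    define s where "s = e / dist x zs"
    have s: "0 < s" "s \<le> 1" using e d by (auto simp: s_def divide_simps)
    let ?w = "s *\<^sub>R x + (1 - s) *\<^sub>R zs"
    have "?w \<in> C" using convexD[OF C(2) x C(3), of s "1 - s"] s by simp
    moreover have "zs - ?w = s *\<^sub>R (zs - x)" by (simp add: algebra_simps)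
    then have "dist zs ?w = s * dist x zs"
      using s by (simp add: dist_norm norm_minus_commute)
    then have "dist zs ?w = e" using e d by (auto simp: s_def)
    moreover have "h ?w \<le> h x"
    proof (cases "s = 1")
      case False
      have "(1 - s) * h zs \<le> (1 - s) * h x" using s min[OF x] by (intro mult_left_mono) auto
      moreover have "x \<noteq> zs" using d e by auto
      ultimately show ?thesis
        using strict[OF x, of s] s False by (simp add: algebra_simps)
    qed simp
    ultimately show ?thesis by auto
  qed
  show "eventually (\<lambda>t. dist (z t) zs < e) F"
  proof (cases "?K = {}")
    case True
    from zC show ?thesis
    proof eventually_elim
      case (elim t)
      then show ?case using seg[of "z t", unfolded True] by force
    qed
  next
    case False
    have "compact ?K" using C by (auto intro: closed_Int_compact)
    moreover have "continuous_on ?K h" using cont by (rule continuous_on_subset) auto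
    ultimately obtain w where w: "w \<in> ?K" "\<And>x. x \<in> ?K \<Longrightarrow> h w \<le> h x"
      using continuous_attains_inf[OF _ False] by blast
    have "w \<noteq> zs" using w(1) e by auto
    have "h zs < h w"
    proof -
      have "(1/2) *\<^sub>R w + (1 - 1/2) *\<^sub>R zs \<in> C"
        using convexD[OF C(2) _ C(3), of w "1/2" "1/2"] w(1) by simp
      from min[OF this] strict[of w "1/2"] w(1) \<open>w \<noteq> zs\<close> show ?thesis by simp
    qed
    then have "eventually (\<lambda>t. h (z t) < h w) F"
      using lim by (rule order_tendstoD(2)[rotated])
    with zC show ?thesis
    proof eventually_elim
      case (elim t)
      then show ?case using seg[of "z t"] w(2) by (meson not_le order_trans)
    qed
  qed
qed


section \<open>Differential inequalities on a ray\<close>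

lemma nonincreasing_on_ray:
  fixes h :: "real \<Rightarrow> real"
  assumes deriv: "\<And>t. t \<ge> t0 \<Longrightarrow> \<exists>D\<le>0. (h has_real_derivative D) (at t within {t0..})"
    and t: "t0 \<le> t"
  shows "h t \<le> h t0"
proof -
  obtain D where D: "\<And>s. s \<ge> t0 \<Longrightarrow> D s \<le> 0 \<and> (h has_real_derivative D s) (at s within {t0..})"
    using deriv by metis
  have "\<exists>s\<in>{t0..t}. h t - h t0 = D s * (t - t0)"
  proof (rule mvt_very_simple[OF t])
    fix s assume "t0 \<le> s" "s \<le> t"
    then show "(h has_derivative (*) (D s)) (at s within {t0..t})"
      using D[of s] by (auto simp: has_field_derivative_def intro: has_derivative_subset)
  qed
  then obtain s where "s \<in> {t0..t}" "h t - h t0 = D s * (t - t0)" by blast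
  moreover have "D s * (t - t0) \<le> 0"
    using D[of s] \<open>s \<in> {t0..t}\<close> t by (intro mult_nonpos_nonneg) auto
  ultimately show ?thesis by linarith
qed

text \<open>
  The solution of \<open>z' = (r/t) (p - z)\<close> is an average of \<open>z t0\<close> and the values of \<open>p\<close> with weight
  proportional to \<open>s powr (r - 1)\<close>. An integral of \<open>p\<close> is avoided by arguing with a separating
  hyperplane: with the integrating factor \<open>s powr r\<close>, the violation of an affine
  inequality valid on \<open>C\<close> cannot increase.
\<close>

lemma relaxation_stays_in_convex_set:
  fixes z p :: "real \<Rightarrow> 'a::euclidean_space"
  assumes C: "closed C" "convex C" and t0: "t0 > 0" and r: "r > 0"
    and init: "z t0 \<in> C" and p: "\<And>t. t \<ge> t0 \<Longrightarrow> p t \<in> C"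
    and deriv: "\<And>t. t \<ge> t0 \<Longrightarrow> (z has_vector_derivative (r / t) *\<^sub>R (p t - z t)) (at t within {t0..})"
    and t: "t \<ge> t0"
  shows "z t \<in> C"
proof (rule ccontr)
  assume "z t \<notin> C"
  then obtain a b where ab: "a \<bullet> z t < b" "\<And>x. x \<in> C \<Longrightarrow> b < a \<bullet> x"
    using separating_hyperplane_closed_point[OF C(2,1)] by metis
  define h where "h s = s powr r * (b - a \<bullet> z s)" for s
  have "h t \<le> h t0"
  proof (rule nonincreasing_on_ray[OF _ t])
    fix s assume s: "t0 \<le> s"
    have "((\<lambda>s. a \<bullet> z s) has_vector_derivative a \<bullet> ((r / s) *\<^sub>R (p s - z s))) (at s within {t0..})"
      by (rule bounded_linear.has_vector_derivative[OF bounded_linear_inner_right deriv[OF s]])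
    then have dz: "((\<lambda>s. a \<bullet> z s) has_real_derivative r / s * (a \<bullet> p s - a \<bullet> z s)) (at s within {t0..})"
      by (simp add: has_real_derivative_iff_has_vector_derivative inner_diff_right)
    have dp: "((\<lambda>s. s powr r) has_real_derivative r * s powr (r - 1)) (at s within {t0..})"
      using s t0 by (auto intro!: derivative_eq_intros)
    have "(h has_real_derivative s powr r * (0 - r / s * (a \<bullet> p s - a \<bullet> z s))
        + r * s powr (r - 1) * (b - a \<bullet> z s)) (at s within {t0..})"
      unfolding h_def by (intro DERIV_mult' DERIV_diff DERIV_const dz dp)
    moreover have "s powr r * (0 - r / s * (a \<bullet> p s - a \<bullet> z s)) + r * s powr (r - 1) * (b - a \<bullet> z s)
        = r * s powr (r - 1) * (b - a \<bullet> p s)"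
      using s t0 by (simp add: powr_diff field_simps)
    moreover have "r * s powr (r - 1) * (b - a \<bullet> p s) \<le> 0"
      using r ab(2)[OF p[OF s]] by (intro mult_nonneg_nonpos) auto
    ultimately show "\<exists>D\<le>0. (h has_real_derivative D) (at s within {t0..})"
      by metis
  qed
  also have "h t0 \<le> 0"
    unfolding h_def using ab(2)[OF init] by (intro mult_nonneg_nonpos) auto
  finally have "h t \<le> 0" .
  moreover have "h t > 0" unfolding h_def using ab(1) t t0 by simp
  ultimately show False by simp
qed


section \<open>One side of the game\<close>

definition block_cost ::
    "('n::finite \<Rightarrow> 'a::real_inner \<Rightarrow> real) \<Rightarrow> 'a ^ 'n \<Rightarrow> ('a ^ 'n \<Rightarrow> 'a ^ 'n) \<Rightarrow> 'a ^ 'n \<Rightarrow> real" where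
  "block_cost f b L z = (\<Sum>i\<in>UNIV. f i (z $ i)) + z \<bullet> b + 1/2 * (z \<bullet> L z)"

definition mirror_map ::
    "('n \<Rightarrow> 'a::real_inner set) \<Rightarrow> ('n \<Rightarrow> 'a \<Rightarrow> real) \<Rightarrow> 'a ^ 'n \<Rightarrow> 'a ^ 'n" where
  "mirror_map C \<psi> w = (\<chi> i. gradient (conjugate_on (C i) (\<psi> i)) (w $ i))"

lemma has_vector_derivative_blocks:
  fixes z :: "real \<Rightarrow> 'a::euclidean_space ^ 'n"
  assumes "\<And>i. ((\<lambda>s. z s $ i) has_vector_derivative d $ i) (at t within T)"
  shows "(z has_vector_derivative d) (at t within T)"
  unfolding has_vector_derivative_def
proof (subst has_derivative_componentwise_within, safe)
  fix b :: "'a ^ 'n" assume "b \<in> Basis"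
  then obtain i w where b: "b = axis i w" by (auto simp: Basis_vec_def)
  have "((\<lambda>s. z s $ i \<bullet> w) has_derivative (\<lambda>h. (h *\<^sub>R d $ i) \<bullet> w)) (at t within T)"
    by (rule has_derivative_inner_left[OF assms[of i, unfolded has_vector_derivative_def]])
  then show "((\<lambda>s. z s \<bullet> b) has_derivative (\<lambda>h. (h *\<^sub>R d) \<bullet> b)) (at t within T)"
    by (simp add: b inner_axis)
qed

text \<open>
  One side of the game, in the form both sides take once extrapolated states are replaced by mirror
  points: \<open>z\<close> is the state, \<open>u\<close> its mirror variable and \<open>c\<close> the extrapolated multiplier. \<open>F t\<close> is
  the gradient of the separable cost that the dynamics use at time \<open>t\<close>, and \<open>e\<close> is the signal
  received from the opponent; \<open>zs\<close>, \<open>ls\<close> and \<open>es\<close> are the state, the multiplier and the signal at the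
  saddle point.
\<close>

locale player =
  fixes C :: "'n::finite \<Rightarrow> 'a::euclidean_space set"
    and f \<psi> :: "'n \<Rightarrow> 'a \<Rightarrow> real" and L :: "'a ^ 'n \<Rightarrow> 'a ^ 'n"
    and r t0 :: real and z u c F e :: "real \<Rightarrow> 'a ^ 'n" and zs ls es :: "'a ^ 'n"
  assumes C: "closed (C i)" "convex (C i)"
    and f: "strictly_convex_on (C i) (f i)" "continuous_on (C i) (f i)"
    and \<psi>: "C1_lipschitz_gradient_on (C i) (\<psi> i)" "strongly_convex_on (C i) (\<psi> i)"
    and L: "linear L" "\<And>a b. a \<bullet> L b = b \<bullet> L a" "\<And>a. 0 \<le> a \<bullet> L a"
    and t0: "t0 > 0" and r: "r \<ge> 2"
    and z_deriv: "t \<ge> t0 \<Longrightarrow>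
      (z has_vector_derivative (r / t) *\<^sub>R (mirror_map C \<psi> (u t) - z t)) (at t within {t0..})"
    and u_deriv: "t \<ge> t0 \<Longrightarrow>
      (u has_vector_derivative - ((t / r) *\<^sub>R (F t + e t + L (c t) + L (z t)))) (at t within {t0..})"
    and c_deriv: "t \<ge> t0 \<Longrightarrow>
      (c has_vector_derivative (t / r) *\<^sub>R L (mirror_map C \<psi> (u t))) (at t within {t0..})"
    and F: "t \<ge> t0 \<Longrightarrow> has_gradient_within (f i) (F t $ i) (z t $ i) (C i)"
    and init: "z t0 = mirror_map C \<psi> (u t0)"
    and zs: "zs \<in> block_product C" "L zs = 0"
    and minimizer: "w \<in> block_product C \<Longrightarrow>
      block_cost f (es + L ls) L zs \<le> block_cost f (es + L ls) L w"
begin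

abbreviation "\<Phi> \<equiv> block_cost f (es + L ls) L"
abbreviation "p t \<equiv> mirror_map C \<psi> (u t)"

text \<open>
  A Bregman distance between mirror variables would presuppose a mirror preimage of \<open>zs\<close>; the
  Fenchel-Young gap of the generating functions at \<open>zs\<close> takes its place.
\<close>

definition energy :: "real \<Rightarrow> real" where
  "energy t = (t / r)\<^sup>2 * (\<Phi> (z t) - \<Phi> zs)
     + (\<Sum>i\<in>UNIV. conjugate_on (C i) (\<psi> i) (u t $ i) - (zs $ i \<bullet> u t $ i - \<psi> i (zs $ i)))
     + 1/2 * ((c t - ls) \<bullet> (c t - ls))"

lemmas conjugate = gradient_conjugate[OF C(1) _ \<psi>]

lemma C_nonempty: "C i \<noteq> {}"
  using zs(1) by (auto simp: block_product_def)

lemma bounded_linear_L: "bounded_linear L"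
  using L(1) by (simp add: linear_conv_bounded_linear)

lemma p_in: "p t $ i \<in> C i"
  using conjugate(1)[OF C_nonempty] by (simp add: mirror_map_def)

lemma block_deriv:
  assumes "(w has_vector_derivative d) (at t within T)"
  shows "((\<lambda>s. w s $ i) has_vector_derivative d $ i) (at t within T)"
  using bounded_linear.has_vector_derivative[OF bounded_linear_vec_nth assms] .

lemma z_in: "t \<ge> t0 \<Longrightarrow> z t $ i \<in> C i"
proof (rule relaxation_stays_in_convex_set[where p = "\<lambda>t. p t $ i", OF C t0])
  show "z t0 $ i \<in> C i" using init p_in by simp
  show "((\<lambda>s. z s $ i) has_vector_derivative (r / t) *\<^sub>R (p t $ i - z t $ i)) (at t within {t0..})"
    if "t \<ge> t0" for t
    using block_deriv[OF z_deriv[OF that], of i] by simp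
qed (use r p_in in auto)

lemma cost_gap_nonneg: "t \<ge> t0 \<Longrightarrow> 0 \<le> \<Phi> (z t) - \<Phi> zs"
  using minimizer[of "z t"] z_in by (simp add: block_product_def)

lemma cost_gap_le_energy:
  assumes "t \<ge> t0"
  shows "(t / r)\<^sup>2 * (\<Phi> (z t) - \<Phi> zs) \<le> energy t"
proof -
  have "0 \<le> (\<Sum>i\<in>UNIV. conjugate_on (C i) (\<psi> i) (u t $ i) - (zs $ i \<bullet> u t $ i - \<psi> i (zs $ i)))"
    using zs(1) conjugate(3)[OF C_nonempty] by (intro sum_nonneg) (auto simp: block_product_def)
  then show ?thesis by (simp add: energy_def)
qed

lemma cost_gap_le_inner:
  assumes t: "t \<ge> t0"
  shows "\<Phi> (z t) - \<Phi> zs \<le> (z t - zs) \<bullet> (F t + (es + L ls) + L (z t))"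
proof -
  have "f i (z t $ i) + (zs - z t) $ i \<bullet> F t $ i \<le> f i (zs $ i)" for i
    using strictly_convex_gradient_inequality[OF F[OF t] f(1) z_in[OF t], of "zs $ i" i] zs(1)
    by (simp add: block_product_def)
  then have "(\<Sum>i\<in>UNIV. f i (z t $ i) + (zs - z t) $ i \<bullet> F t $ i) \<le> (\<Sum>i\<in>UNIV. f i (zs $ i))"
    by (intro sum_mono)
  then have "(\<Sum>i\<in>UNIV. f i (z t $ i)) + (zs - z t) \<bullet> F t \<le> (\<Sum>i\<in>UNIV. f i (zs $ i))"
    by (simp add: sum.distrib inner_vec_def)
  moreover have "zs \<bullet> L (z t) = 0" using L(2)[of zs] zs(2) by simp
  ultimately show ?thesis
    using L(3)[of "z t"] zs(2) by (simp add: block_cost_def inner_diff_left inner_add_right)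
qed

lemma cost_deriv:
  assumes t: "t \<ge> t0"
  shows "((\<lambda>s. \<Phi> (z s)) has_real_derivative
    (r / t) * ((p t - z t) \<bullet> (F t + (es + L ls) + L (z t)))) (at t within {t0..})"
proof -
  define d where "d = (r / t) *\<^sub>R (p t - z t)"
  have zd: "(z has_vector_derivative d) (at t within {t0..})"
    unfolding d_def by (rule z_deriv[OF t])
  have Lzd: "((\<lambda>s. L (z s)) has_vector_derivative L d) (at t within {t0..})"
    by (rule bounded_linear.has_vector_derivative[OF bounded_linear_L zd])
  have "((\<lambda>s. f i (z s $ i)) has_real_derivative d $ i \<bullet> F t $ i) (at t within {t0..})" for i
    using z_in by (intro has_real_derivative_along_curve[OF F[OF t] block_deriv[OF zd]]) auto
  then have fd: "((\<lambda>s. \<Sum>i\<in>UNIV. f i (z s $ i)) has_real_derivative d \<bullet> F t) (at t within {t0..})"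
    unfolding inner_vec_def by (intro DERIV_sum) simp
  have bd: "((\<lambda>s. z s \<bullet> (es + L ls)) has_real_derivative d \<bullet> (es + L ls)) (at t within {t0..})"
    using bounded_linear.has_vector_derivative[OF bounded_linear_inner_left zd]
    by (simp add: has_real_derivative_iff_has_vector_derivative)
  have qd: "((\<lambda>s. z s \<bullet> L (z s)) has_real_derivative z t \<bullet> L d + d \<bullet> L (z t)) (at t within {t0..})"
    using bounded_bilinear.has_vector_derivative[OF bounded_bilinear_inner zd Lzd]
    by (simp add: has_real_derivative_iff_has_vector_derivative)
  have "((\<lambda>s. \<Phi> (z s)) has_real_derivative
      d \<bullet> F t + d \<bullet> (es + L ls) + 1/2 * (z t \<bullet> L d + d \<bullet> L (z t))) (at t within {t0..})"
    unfolding block_cost_def by (intro DERIV_add DERIV_cmult fd bd qd)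
  moreover have "d \<bullet> F t + d \<bullet> (es + L ls) + 1/2 * (z t \<bullet> L d + d \<bullet> L (z t))
      = (r / t) * ((p t - z t) \<bullet> (F t + (es + L ls) + L (z t)))"
  proof -
    have "d \<bullet> F t + d \<bullet> (es + L ls) + 1/2 * (z t \<bullet> L d + d \<bullet> L (z t))
        = d \<bullet> (F t + (es + L ls) + L (z t))"
      using L(2)[of "z t" d] by (simp add: inner_add_right)
    then show ?thesis by (simp add: d_def)
  qed
  ultimately show ?thesis by simp
qed

text \<open>
  Up to the factor \<open>t/r\<close>, the term from \<open>\<Phi>\<close> pairs its gradient \<open>g\<close> with \<open>p - z\<close>, and the mirror
  term pairs \<open>-(g + (e - es) + L (c - ls))\<close> with \<open>p - zs\<close>. The pairing of \<open>g\<close> with the uncontrolled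
  point \<open>p\<close> cancels between them, and the multiplier term cancels
  \<open>L (c - ls)\<close> since \<open>L\<close> is symmetric and \<open>L zs = 0\<close>. What remains besides the exchange with the opponent is
  \<open>-(t/r) \<langle>z - zs, g\<rangle>\<close>, which by convexity is at most \<open>-(t/r)\<close> times the cost gap and so pays for the
  derivative \<open>2t/r\<^sup>2\<close> of the weight.
\<close>

lemma energy_deriv:
  assumes t: "t \<ge> t0"
  shows "\<exists>D \<le> - ((t / r) * ((p t - zs) \<bullet> (e t - es))).
    (energy has_real_derivative D) (at t within {t0..})"
proof -
  have pos: "t > 0" "r > 0" using t t0 r by auto
  \<comment> \<open>The velocity of \<open>u\<close> is \<open>-(t/r) v\<close>, and \<open>g\<close> is a gradient of \<open>\<Phi>\<close> at \<open>z t\<close>.\<close>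
  define v where "v = F t + e t + L (c t) + L (z t)"
  define \<Delta> where "\<Delta> = \<Phi> (z t) - \<Phi> zs"
  define g where "g = F t + (es + L ls) + L (z t)"
  have conj: "((\<lambda>s. conjugate_on (C i) (\<psi> i) (u s $ i) - (zs $ i \<bullet> u s $ i - \<psi> i (zs $ i)))
      has_real_derivative - ((t / r) * ((p t - zs) $ i \<bullet> v $ i))) (at t within {t0..})" for i
  proof -
    have ud: "((\<lambda>s. u s $ i) has_vector_derivative (- ((t / r) *\<^sub>R v)) $ i) (at t within {t0..})"
      unfolding v_def by (rule block_deriv[OF u_deriv[OF t]])
    have "has_gradient_within (conjugate_on (C i) (\<psi> i)) (p t $ i) (u t $ i) UNIV"
      using conjugate(2)[OF C_nonempty, of i "u t $ i"]
      by (simp add: has_gradient_within_def gderiv_def mirror_map_def)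
    then have "((\<lambda>s. conjugate_on (C i) (\<psi> i) (u s $ i)) has_real_derivative
        (- ((t / r) *\<^sub>R v)) $ i \<bullet> p t $ i) (at t within {t0..})"
      by (rule has_real_derivative_along_curve[OF _ ud]) simp
    moreover have "((\<lambda>s. zs $ i \<bullet> u s $ i) has_real_derivative zs $ i \<bullet> (- ((t / r) *\<^sub>R v)) $ i)
        (at t within {t0..})"
      using bounded_linear.has_vector_derivative[OF bounded_linear_inner_right ud]
      by (simp add: has_real_derivative_iff_has_vector_derivative)
    ultimately have "((\<lambda>s. conjugate_on (C i) (\<psi> i) (u s $ i) - (zs $ i \<bullet> u s $ i - \<psi> i (zs $ i)))
      has_real_derivative (- ((t / r) *\<^sub>R v)) $ i \<bullet> p t $ i - (zs $ i \<bullet> (- ((t / r) *\<^sub>R v)) $ i - 0))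
      (at t within {t0..})"
      by (intro DERIV_diff DERIV_const)
    moreover have "(- ((t / r) *\<^sub>R v)) $ i \<bullet> p t $ i - (zs $ i \<bullet> (- ((t / r) *\<^sub>R v)) $ i - 0)
        = - ((t / r) * ((p t - zs) $ i \<bullet> v $ i))"
      by (simp add: inner_diff_left inner_commute[of "v $ i"] algebra_simps)
    ultimately show ?thesis by simp
  qed
  have quad: "((\<lambda>s. 1/2 * ((c s - ls) \<bullet> (c s - ls))) has_real_derivative
      (t / r) * ((c t - ls) \<bullet> L (p t))) (at t within {t0..})"
  proof -
    have "((\<lambda>s. c s - ls) has_vector_derivative (t / r) *\<^sub>R L (p t) - 0) (at t within {t0..})"
      by (intro has_vector_derivative_diff c_deriv[OF t] has_vector_derivative_const)
    from bounded_bilinear.has_vector_derivative[OF bounded_bilinear_inner this this]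
    have "((\<lambda>s. (c s - ls) \<bullet> (c s - ls)) has_real_derivative
        2 * ((t / r) * ((c t - ls) \<bullet> L (p t)))) (at t within {t0..})"
      by (simp add: has_real_derivative_iff_has_vector_derivative inner_commute)
    from DERIV_cmult[OF this, of "1/2"] show ?thesis by simp
  qed
  have scaled: "((\<lambda>s. (s / r)\<^sup>2 * (\<Phi> (z s) - \<Phi> zs)) has_real_derivative
      (t / r)\<^sup>2 * ((r / t) * ((p t - z t) \<bullet> g) - 0) + 2 * t / r\<^sup>2 * \<Delta>) (at t within {t0..})"
    unfolding \<Delta>_def
  proof (rule DERIV_mult')
    show "((\<lambda>s. (s / r)\<^sup>2) has_real_derivative 2 * t / r\<^sup>2) (at t within {t0..})"
      using pos by (auto intro!: derivative_eq_intros simp: power2_eq_square)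
    show "((\<lambda>s. \<Phi> (z s) - \<Phi> zs) has_real_derivative (r / t) * ((p t - z t) \<bullet> g) - 0)
        (at t within {t0..})"
      unfolding g_def by (intro DERIV_diff DERIV_const cost_deriv[OF t])
  qed
  define D where "D = (t / r)\<^sup>2 * ((r / t) * ((p t - z t) \<bullet> g) - 0) + 2 * t / r\<^sup>2 * \<Delta>
      + (\<Sum>i\<in>UNIV. - ((t / r) * ((p t - zs) $ i \<bullet> v $ i))) + (t / r) * ((c t - ls) \<bullet> L (p t))"
  have "(energy has_real_derivative D) (at t within {t0..})"
    unfolding D_def energy_def[abs_def] by (intro DERIV_add scaled DERIV_sum conj quad)
  moreover have "D \<le> - ((t / r) * ((p t - zs) \<bullet> (e t - es)))"
  proof -
    have sum: "(\<Sum>i\<in>UNIV. - ((t / r) * ((p t - zs) $ i \<bullet> v $ i))) = - ((t / r) * ((p t - zs) \<bullet> v))"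
      by (simp add: inner_vec_def sum_negf sum_distrib_left)
    \<comment> \<open>The force \<open>v\<close> uses the current signal and multiplier, \<open>g\<close> their saddle-point values.\<close>
    have vg: "v = g + (e t - es) + L (c t - ls)"
      by (simp add: v_def g_def linear_diff[OF L(1)])
    have cancel: "(p t - zs) \<bullet> L (c t - ls) = (c t - ls) \<bullet> L (p t)"
      using L(2)[of "p t - zs" "c t - ls"] zs(2) by (simp add: linear_diff[OF L(1)])
    have "D = (t / r) * ((p t - z t) \<bullet> g - (p t - zs) \<bullet> v + (c t - ls) \<bullet> L (p t)) + 2 * t / r\<^sup>2 * \<Delta>"
      unfolding D_def sum using pos by (simp add: power2_eq_square field_simps)
    also have "\<dots> = - ((t / r) * ((p t - zs) \<bullet> (e t - es))) - (t / r) * ((z t - zs) \<bullet> g) + 2 * t / r\<^sup>2 * \<Delta>"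
      unfolding vg inner_add_right cancel by (simp add: inner_diff_left algebra_simps)
    also have "\<dots> \<le> - ((t / r) * ((p t - zs) \<bullet> (e t - es)))"
    proof -
      have "0 \<le> \<Delta>" unfolding \<Delta>_def by (rule cost_gap_nonneg[OF t])
      have "2 * t / r\<^sup>2 * \<Delta> = (t / r) * (2 / r * \<Delta>)" by (simp add: power2_eq_square)
      also have "\<dots> \<le> (t / r) * (1 * \<Delta>)"
        using pos r \<open>0 \<le> \<Delta>\<close> by (intro mult_left_mono mult_right_mono) auto
      also have "\<dots> \<le> (t / r) * ((z t - zs) \<bullet> g)"
        using pos cost_gap_le_inner[OF t] by (intro mult_left_mono) (auto simp: \<Delta>_def g_def)
      finally show ?thesis by simp
    qed
    finally show ?thesis .
  qed
  ultimately show ?thesis by blast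
qed

text \<open>
  Strictness comes from the separable part in one differing block; along segments to \<open>zs\<close> the
  quadratic form scales with \<open>s\<^sup>2 \<le> s\<close> because \<open>L zs = 0\<close>.
\<close>

lemma converges_if_cost_converges:
  assumes lim: "((\<lambda>t. \<Phi> (z t) - \<Phi> zs) \<longlongrightarrow> 0) at_top"
  shows "(z \<longlongrightarrow> zs) at_top"
proof (rule strict_minimizer_attracts[where h = \<Phi> and C = "block_product C"])
  have eq: "block_product C = (\<Inter>i. (\<lambda>w. w $ i) -` C i)"
    by (auto simp: block_product_def)
  show "closed (block_product C)"
    unfolding eq by (intro closed_INT ballI closed_vimage C continuous_intros)
  show "convex (block_product C)"
    using C(2) by (auto simp: block_product_def convex_def)
  show "continuous_on (block_product C) \<Phi>"
    unfolding block_cost_def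
    by (intro continuous_intros continuous_on_compose2[OF f(2)]
        bounded_linear.continuous_on[OF bounded_linear_L]) (auto simp: block_product_def)
  show "\<Phi> (s *\<^sub>R w + (1 - s) *\<^sub>R zs) < s * \<Phi> w + (1 - s) * \<Phi> zs"
    if w: "w \<in> block_product C" "w \<noteq> zs" and s: "0 < s" "s < 1" for w s
  proof -
    have le: "f i (s *\<^sub>R w $ i + (1 - s) *\<^sub>R zs $ i) \<le> s * f i (w $ i) + (1 - s) * f i (zs $ i)"
      and less: "w $ i \<noteq> zs $ i \<Longrightarrow>
        f i (s *\<^sub>R w $ i + (1 - s) *\<^sub>R zs $ i) < s * f i (w $ i) + (1 - s) * f i (zs $ i)" for i
    proof -
      have in_C: "w $ i \<in> C i" "zs $ i \<in> C i"
        using w(1) zs(1) by (auto simp: block_product_def)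
      show less: "f i (s *\<^sub>R w $ i + (1 - s) *\<^sub>R zs $ i) < s * f i (w $ i) + (1 - s) * f i (zs $ i)"
        if "w $ i \<noteq> zs $ i"
        using f(1)[of i, unfolded strictly_convex_on_def, THEN conjunct2, rule_format, OF in_C, of s]
          that s by simp
      show "f i (s *\<^sub>R w $ i + (1 - s) *\<^sub>R zs $ i) \<le> s * f i (w $ i) + (1 - s) * f i (zs $ i)"
        using less by (cases "w $ i = zs $ i") (auto simp: algebra_simps)
    qed
    let ?q = "s *\<^sub>R w + (1 - s) *\<^sub>R zs"
    define fq fw fz where "fq = (\<Sum>i\<in>UNIV. f i (?q $ i))"
      and "fw = (\<Sum>i\<in>UNIV. f i (w $ i))" and "fz = (\<Sum>i\<in>UNIV. f i (zs $ i))"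
    obtain k where "w $ k \<noteq> zs $ k" using w(2) by (auto simp: vec_eq_iff)
    then have "(\<Sum>i\<in>UNIV. f i (s *\<^sub>R w $ i + (1 - s) *\<^sub>R zs $ i))
        < (\<Sum>i\<in>UNIV. s * f i (w $ i) + (1 - s) * f i (zs $ i))"
      using le less by (intro sum_strict_mono_ex1) auto
    then have costs: "fq < s * fw + (1 - s) * fz"
      by (simp add: fq_def fw_def fz_def sum.distrib sum_distrib_left)
    have "zs \<bullet> L w = 0" using L(2)[of zs] zs(2) by simp
    then have quad: "?q \<bullet> L ?q = s * (s * (w \<bullet> L w))"
      by (simp add: linear_add[OF L(1)] linear_scale[OF L(1)] zs(2) inner_add_left)
    have "s * (s * (w \<bullet> L w)) \<le> s * (1 * (w \<bullet> L w))"
      using s L(3) by (intro mult_left_mono mult_right_mono) auto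
    with quad have "?q \<bullet> L ?q \<le> s * (w \<bullet> L w)" by simp
    with costs show ?thesis
      unfolding block_cost_def fq_def[symmetric] fw_def[symmetric] fz_def[symmetric]
      by (simp add: inner_add_left zs(2) distrib_left)
  qed
  show "((\<lambda>t. \<Phi> (z t)) \<longlongrightarrow> \<Phi> zs) at_top"
    using lim by (simp add: LIM_zero_iff)
  show "\<forall>\<^sub>F t in at_top. z t \<in> block_product C"
    using eventually_ge_at_top[of t0] by eventually_elim (simp add: block_product_def z_in)
qed (use zs(1) minimizer in auto)

end


section \<open>The graph Laplacian\<close>

lemma linear_kron_id_mult: "linear (kron_id_mult A)"
  by (rule linearI)
    (simp_all add: kron_id_mult_def vec_eq_iff scaleR_right_distrib sum.distrib scaleR_sum_right mult.commute)

lemma inner_kron_id_mult: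
  "a \<bullet> kron_id_mult A b = (\<Sum>i\<in>UNIV. \<Sum>k\<in>UNIV. A $ i $ k * (a $ i \<bullet> b $ k))"
  by (simp add: kron_id_mult_def inner_vec_def[of a] inner_sum_right)

lemma kron_id_mult_symmetric:
  assumes "transpose A = A"
  shows "a \<bullet> kron_id_mult A b = b \<bullet> kron_id_mult A a"
proof -
  have "A $ k $ i = A $ i $ k" for i k
    using arg_cong[OF assms, of "\<lambda>M. M $ i $ k"] by (simp add: transpose_def)
  then have "a \<bullet> kron_id_mult A b = (\<Sum>i\<in>UNIV. \<Sum>k\<in>UNIV. A $ k $ i * (b $ k \<bullet> a $ i))"
    unfolding inner_kron_id_mult
    by (intro sum.cong refl arg_cong2[where f = "(*)"] inner_commute) simp
  also have "\<dots> = b \<bullet> kron_id_mult A a"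
    unfolding inner_kron_id_mult by (rule sum.swap)
  finally show ?thesis .
qed

lemma connected_weighted_graph_symmetric:
  assumes "connected_weighted_graph E w"
  shows "w $ i $ k = w $ k $ i" and "0 \<le> w $ i $ k"
proof -
  have "transpose w = w" using assms by (simp add: connected_weighted_graph_def)
  from arg_cong[OF this, of "\<lambda>M. M $ k $ i"] show "w $ i $ k = w $ k $ i"
    by (simp add: transpose_def)
  show "0 \<le> w $ i $ k"
    using assms unfolding connected_weighted_graph_def
    by (cases "(i, k) \<in> E") (simp_all add: less_imp_le)
qed

lemma laplacian_symmetric:
  assumes "connected_weighted_graph E w"
  shows "a \<bullet> kron_id_mult (laplacian w) b = b \<bullet> kron_id_mult (laplacian w) a"
proof (rule kron_id_mult_symmetric)
  have "laplacian w $ k $ i = laplacian w $ i $ k" for i k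
    using connected_weighted_graph_symmetric(1)[OF assms, of i k] by (auto simp: laplacian_def)
  then show "transpose (laplacian w) = laplacian w"
    by (simp add: transpose_def vec_eq_iff)
qed

text \<open>
  Twice the quadratic form is the weighted sum of the squared differences over all ordered pairs.
\<close>

lemma laplacian_nonneg:
  assumes w: "connected_weighted_graph E w"
  shows "0 \<le> a \<bullet> kron_id_mult (laplacian w) a"
proof -
  have row: "(\<Sum>k\<in>UNIV. laplacian w $ i $ k * (a $ i \<bullet> a $ k))
      = (\<Sum>k\<in>UNIV. w $ i $ k * (a $ i \<bullet> a $ i - a $ i \<bullet> a $ k))" for i
  proof -
    have "laplacian w $ i $ k * s = (if i = k then (\<Sum>l\<in>UNIV. w $ i $ l) * s else 0) - w $ i $ k * s"
      for k s
      by (simp add: laplacian_def left_diff_distrib)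
    then show ?thesis
      by (simp add: right_diff_distrib sum_subtractf sum_distrib_right)
  qed
  let ?s = "\<Sum>i\<in>UNIV. \<Sum>k\<in>UNIV. w $ i $ k * (a $ i \<bullet> a $ i - a $ i \<bullet> a $ k)"
  have "?s = (\<Sum>i\<in>UNIV. \<Sum>k\<in>UNIV. w $ k $ i * (a $ k \<bullet> a $ k - a $ k \<bullet> a $ i))"
    by (rule sum.swap)
  also have "\<dots> = (\<Sum>i\<in>UNIV. \<Sum>k\<in>UNIV. w $ i $ k * (a $ k \<bullet> a $ k - a $ k \<bullet> a $ i))"
    by (intro sum.cong refl arg_cong2[where f = "(*)"] connected_weighted_graph_symmetric(1)[OF w])
  finally have "?s + ?s = ?s + (\<Sum>i\<in>UNIV. \<Sum>k\<in>UNIV. w $ i $ k * (a $ k \<bullet> a $ k - a $ k \<bullet> a $ i))"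
    by simp
  also have "\<dots> = (\<Sum>i\<in>UNIV. \<Sum>k\<in>UNIV. w $ i $ k * ((a $ i - a $ k) \<bullet> (a $ i - a $ k)))"
    unfolding sum.distrib[symmetric]
    by (intro sum.cong refl)
      (simp add: inner_diff_left inner_diff_right inner_commute algebra_simps)
  also have "\<dots> \<ge> 0"
    using connected_weighted_graph_symmetric(2)[OF w] by (intro sum_nonneg mult_nonneg_nonneg) auto
  finally show ?thesis
    unfolding inner_kron_id_mult row by simp
qed


section \<open>The Lagrangian as a difference of block costs\<close>

definition coupling ::
    "('n1 \<Rightarrow> 'n2::finite \<Rightarrow> real ^ 'p2 ^ 'p1) \<Rightarrow> (real ^ 'p2) ^ 'n2 \<Rightarrow> (real ^ 'p1) ^ 'n1" where
  "coupling H y = (\<chi> i. \<Sum>j\<in>UNIV. H i j *v y $ j)"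

lemma coupling_adjoint:
  fixes H :: "'n1::finite \<Rightarrow> 'n2::finite \<Rightarrow> real ^ 'p2::finite ^ 'p1::finite"
  shows "y \<bullet> coupling (\<lambda>j i. transpose (H i j)) x = x \<bullet> coupling H y"
proof -
  have adj: "v \<bullet> (transpose A *v w) = w \<bullet> (A *v v)" for A :: "real ^ 'p2 ^ 'p1" and v w
    by (simp add: dot_lmul_matrix[symmetric] inner_commute)
  show ?thesis
    unfolding coupling_def inner_vec_def[of x] inner_vec_def[of y] inner_sum_right vec_lambda_beta adj
    by (rule sum.swap)
qed

lemma coupling_diff: "coupling H (x - y) = coupling H x - coupling H y"
  by (simp add: coupling_def vec_eq_iff matrix_vector_mult_diff_distrib sum_subtractf)

text \<open>
  The coupling term can be attributed to either player. In this form the variable \<open>x\<close> occurs in one cost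
  only, in the next one \<open>y\<close> does.
\<close>

lemma lagrangian_as_min_cost:
  assumes "connected_weighted_graph E1 w1" "connected_weighted_graph E2 w2"
  shows "augmented_lagrangian (payoff f g H) w1 w2 x l y m =
    block_cost f (coupling H y + kron_id_mult (laplacian w1) l) (kron_id_mult (laplacian w1)) x
    - block_cost g (kron_id_mult (laplacian w2) m) (kron_id_mult (laplacian w2)) y"
proof -
  have "(\<Sum>i\<in>UNIV. \<Sum>j\<in>UNIV. x $ i \<bullet> (H i j *v y $ j)) = x \<bullet> coupling H y"
    by (simp add: coupling_def inner_vec_def[of x] inner_sum_right)
  then show ?thesis
    using laplacian_symmetric[OF assms(1), of l x] laplacian_symmetric[OF assms(2), of m y]
    by (simp add: augmented_lagrangian_def payoff_def block_cost_def inner_add_right)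
qed

lemma lagrangian_as_max_cost:
  assumes "connected_weighted_graph E1 w1" "connected_weighted_graph E2 w2"
  shows "augmented_lagrangian (payoff f g H) w1 w2 x l y m =
    block_cost f (kron_id_mult (laplacian w1) l) (kron_id_mult (laplacian w1)) x
    - block_cost g (- coupling (\<lambda>j i. transpose (H i j)) x + kron_id_mult (laplacian w2) m)
        (kron_id_mult (laplacian w2)) y"
  unfolding lagrangian_as_min_cost[OF assms]
  by (simp add: block_cost_def inner_add_right inner_diff_right coupling_adjoint)

lemma block_upd_has_derivative:
  fixes z :: "'a::euclidean_space ^ 'n"
  shows "(block_upd z i has_derivative axis i) (at w within C)"
proof -
  have eq: "block_upd z i = (\<lambda>w. axis i w + block_upd z i 0)"
    by (auto simp: block_upd_def axis_def vec_eq_iff)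
  have "linear (axis i :: 'a \<Rightarrow> 'a ^ 'n)"
    by (rule linearI) (auto simp: axis_def vec_eq_iff)
  then have "((\<lambda>w. axis i w :: 'a ^ 'n) has_derivative axis i) (at w within C)"
    by (intro bounded_linear_imp_has_derivative) (simp add: linear_conv_bounded_linear)
  then show ?thesis
    by (subst eq) (rule has_derivative_add_const)
qed

lemma block_upd_same: "block_upd z i (z $ i) = z"
  by (simp add: block_upd_def vec_eq_iff)

lemma block_gradient_uminus:
  assumes "has_block_gradient G i C z D"
  shows "has_block_gradient (\<lambda>w. - G w) i C z (- D)"
  using has_derivative_minus[OF assms[unfolded has_block_gradient_def has_gradient_within_def]]
  by (simp add: has_block_gradient_def has_gradient_within_def)

lemma block_gradient_linear:
  fixes b z :: "'a::euclidean_space ^ 'n::finite"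
  assumes "has_block_gradient (\<lambda>w. w \<bullet> b + k) i UNIV z D"
  shows "D = b $ i"
proof -
  have "((\<lambda>w. block_upd z i w \<bullet> b + k) has_derivative (\<lambda>h. axis i h \<bullet> b)) (at (z $ i))"
    by (intro has_derivative_add_const has_derivative_inner_left block_upd_has_derivative)
  moreover have "((\<lambda>w. block_upd z i w \<bullet> b + k) has_derivative (\<lambda>h. h \<bullet> D)) (at (z $ i))"
    using assms by (simp add: has_block_gradient_def has_gradient_within_def)
  ultimately have "(\<lambda>h. axis i h \<bullet> b) = (\<lambda>h. h \<bullet> D)"
    by (rule has_derivative_unique)
  then have "(D - b $ i) \<bullet> b $ i = (D - b $ i) \<bullet> D"
    unfolding inner_axis' by (rule fun_cong)
  then show ?thesis
    by (metis inner_diff_right inner_eq_zero_iff right_minus_eq)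
qed

text \<open>
  A partial gradient of the whole cost within \<open>C\<close> becomes a gradient of \<open>f i\<close> within \<open>C\<close> by subtracting
  the gradient of the smooth remainder, even where neither is unique.
\<close>

lemma block_gradient_cost:
  fixes b z :: "'a::euclidean_space ^ 'n::finite"
  assumes L: "linear L" "\<And>a b. a \<bullet> L b = b \<bullet> L a"
    and D: "has_block_gradient (\<lambda>w. block_cost f b L w + k) i C z D"
  shows "has_gradient_within (f i) (D - (b + L z) $ i) (z $ i) C"
proof -
  let ?w = "block_upd z i" and ?N = "at (z $ i) within C"
  let ?R = "\<lambda>w. (\<Sum>j\<in>UNIV - {i}. f j (z $ j)) + ?w w \<bullet> b + 1/2 * (?w w \<bullet> L (?w w)) + k"
  have f_eq: "f i = (\<lambda>w. block_cost f b L (?w w) + k - ?R w)"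
  proof
    fix w
    have "(\<Sum>j\<in>UNIV. f j (?w w $ j)) = f i w + (\<Sum>j\<in>UNIV - {i}. f j (?w w $ j))"
      by (subst sum.remove[of UNIV i]) (auto simp: block_upd_def)
    also have "(\<Sum>j\<in>UNIV - {i}. f j (?w w $ j)) = (\<Sum>j\<in>UNIV - {i}. f j (z $ j))"
      by (intro sum.cong) (auto simp: block_upd_def)
    finally show "f i w = block_cost f b L (?w w) + k - ?R w"
      by (simp add: block_cost_def)
  qed
  have wd: "(?w has_derivative axis i) ?N" by (rule block_upd_has_derivative)
  have "bounded_linear L" using L(1) by (simp add: linear_conv_bounded_linear)
  from bounded_linear.has_derivative[OF this wd]
  have Ld: "((\<lambda>w. L (?w w)) has_derivative (\<lambda>h. L (axis i h))) ?N" .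
  have "(?R has_derivative
      (\<lambda>h. 0 + axis i h \<bullet> b + 1/2 * (?w (z $ i) \<bullet> L (axis i h) + axis i h \<bullet> L (?w (z $ i))) + 0)) ?N"
    by (intro has_derivative_add has_derivative_const has_derivative_mult_right
        has_derivative_inner_left has_derivative_inner wd Ld)
  then have "(?R has_derivative (\<lambda>h. h \<bullet> (b + L z) $ i)) ?N"
    by (simp add: block_upd_same L(2)[of z "axis i _"] inner_axis' inner_add_right)
  with D[unfolded has_block_gradient_def has_gradient_within_def]
  have "((\<lambda>w. block_cost f b L (?w w) + k - ?R w) has_derivative
      (\<lambda>h. h \<bullet> D - h \<bullet> (b + L z) $ i)) ?N"
    by (rule has_derivative_diff)
  then show ?thesis
    unfolding has_gradient_within_def inner_diff_right f_eq[symmetric] .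
qed


section \<open>The trajectory as two coupled players\<close>

text \<open>
  The extrapolation used in the dynamics exactly undoes the relaxation towards \<open>p\<close>.
\<close>

lemma extrapolated_state:
  fixes z :: "real \<Rightarrow> 'a::real_normed_vector"
  assumes "t0 > 0" "r > 0" "t \<ge> t0"
    and deriv: "(z has_vector_derivative (r / t) *\<^sub>R (p - z t)) (at t within {t0..})"
  shows "z t + (t / r) *\<^sub>R dot t0 z t = p"
proof -
  have "at_right t \<le> at t within {t0..}"
    using assms(3) by (intro at_le) auto
  then have "at t within {t0..} \<noteq> bot"
    using trivial_limit_at_right_real[of t] by (metis bot.extremum_uniqueI)
  then have "dot t0 z t = (r / t) *\<^sub>R (p - z t)"
    using deriv by (rule vector_derivative_within)
  then show ?thesis using assms(1-3) by simp
qed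

text \<open>
  This stacks the block dynamics of a mirror variable and isolates the gradient \<open>F\<close> of the separable
  cost that the trajectory happens to follow.
\<close>

lemma block_gradient_flow_cost:
  fixes b z :: "'a::euclidean_space ^ 'n::finite"
  assumes L: "linear L" "\<And>a b. a \<bullet> L b = b \<bullet> L a"
    and D: "\<And>i. \<exists>D. has_block_gradient (\<lambda>w. block_cost f b L w + k) i (C i) z D \<and>
      ((\<lambda>s. u s $ i) has_vector_derivative - (a *\<^sub>R D)) (at t within T)"
  shows "\<exists>F. (\<forall>i. has_gradient_within (f i) (F $ i) (z $ i) (C i)) \<and>
    (u has_vector_derivative - (a *\<^sub>R (F + b + L z))) (at t within T)"
proof -
  obtain D where D: "\<And>i. has_block_gradient (\<lambda>w. block_cost f b L w + k) i (C i) z (D i)"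
    "\<And>i. ((\<lambda>s. u s $ i) has_vector_derivative - (a *\<^sub>R D i)) (at t within T)"
    using D by metis
  define F where "F = (\<chi> i. D i) - (b + L z)"
  have "has_gradient_within (f i) (F $ i) (z $ i) (C i)" for i
    using block_gradient_cost[OF L D(1)] by (simp add: F_def)
  moreover have "(u has_vector_derivative - (a *\<^sub>R (F + b + L z))) (at t within T)"
    by (rule has_vector_derivative_blocks) (use D(2) in \<open>simp add: F_def\<close>)
  ultimately show ?thesis by blast
qed

lemma block_gradient_flow_linear:
  fixes b z :: "'a::euclidean_space ^ 'n::finite"
  assumes "\<And>i. \<exists>D. has_block_gradient (\<lambda>w. w \<bullet> b + k) i UNIV z D \<and>
      ((\<lambda>s. c s $ i) has_vector_derivative a *\<^sub>R D) (at t within T)"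
  shows "(c has_vector_derivative a *\<^sub>R b) (at t within T)"
proof (rule has_vector_derivative_blocks)
  fix i
  from assms[of i] show "((\<lambda>s. c s $ i) has_vector_derivative (a *\<^sub>R b) $ i) (at t within T)"
    using block_gradient_linear by fastforce
qed

theorem theorem1:
  fixes E1 :: "('n1::finite \<times> 'n1) set" and E2 :: "('n2::finite \<times> 'n2) set"
    and E12 :: "('n1 \<times> 'n2) set"
    and w1 :: "real ^ 'n1 ^ 'n1" and w2 :: "real ^ 'n2 ^ 'n2"
    and X :: "'n1 \<Rightarrow> (real ^ 'p1::finite) set" and Y :: "'n2 \<Rightarrow> (real ^ 'p2::finite) set"
    and f :: "'n1 \<Rightarrow> real ^ 'p1 \<Rightarrow> real" and g :: "'n2 \<Rightarrow> real ^ 'p2 \<Rightarrow> real"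
    and H :: "'n1 \<Rightarrow> 'n2 \<Rightarrow> real ^ 'p2 ^ 'p1"
    and \<psi> :: "'n1 \<Rightarrow> real ^ 'p1 \<Rightarrow> real" and \<phi> :: "'n2 \<Rightarrow> real ^ 'p2 \<Rightarrow> real"
    and U :: "(real ^ 'p1) ^ 'n1 \<Rightarrow> (real ^ 'p2) ^ 'n2 \<Rightarrow> real"
    and S :: "(real ^ 'p1) ^ 'n1 \<Rightarrow> (real ^ 'p1) ^ 'n1 \<Rightarrow>
              (real ^ 'p2) ^ 'n2 \<Rightarrow> (real ^ 'p2) ^ 'n2 \<Rightarrow> real"
    and r t0 :: real
    and x l u c :: "real \<Rightarrow> (real ^ 'p1) ^ 'n1" and y m v n :: "real \<Rightarrow> (real ^ 'p2) ^ 'n2"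
    and xs ls :: "(real ^ 'p1) ^ 'n1" and ys ms :: "(real ^ 'p2) ^ 'n2"
  assumes graph1: "connected_weighted_graph E1 w1"
    and graph2: "connected_weighted_graph E2 w2"
    and X_closed_convex: "\<And>i. closed (X i) \<and> convex (X i)"
    and Y_closed_convex: "\<And>j. closed (Y j) \<and> convex (Y j)"
    and H_edges: "\<And>i j. H i j \<noteq> 0 \<Longrightarrow> (i, j) \<in> E12"
    and U_eq: "U = payoff f g H"
    and S_eq: "S = augmented_lagrangian U w1 w2"
    and A1_f: "\<And>i. C1_lipschitz_gradient_on (X i) (f i) \<and> strictly_convex_on (X i) (f i)"
    and A1_g: "\<And>j. C1_lipschitz_gradient_on (Y j) (g j) \<and> strictly_convex_on (Y j) (g j)"
    and A1_slater_X:
      "\<exists>x0 \<in> rel_interior (block_product X). kron_id_mult (laplacian w1) x0 = 0"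
    and A1_slater_Y:
      "\<exists>y0 \<in> rel_interior (block_product Y). kron_id_mult (laplacian w2) y0 = 0"
    and A1_NE:
      "\<exists>xe ye. nash_equilibrium U (feasible X w1) (feasible Y w2) xe ye \<and>
         (xe, ye) \<in> rel_interior (block_product X \<times> block_product Y)"
    and A2_psi: "\<And>i. C1_lipschitz_gradient_on (X i) (\<psi> i) \<and> strongly_convex_on (X i) (\<psi> i)"
    and A2_phi: "\<And>j. C1_lipschitz_gradient_on (Y j) (\<phi> j) \<and> strongly_convex_on (Y j) (\<phi> j)"
    and A2_psi_conj:
      "\<And>i. \<exists>K. K-lipschitz_on (X i) (gradient (conjugate_on (X i) (\<psi> i)))"
    and A2_phi_conj:
      "\<And>j. \<exists>K. K-lipschitz_on (Y j) (gradient (conjugate_on (Y j) (\<phi> j)))"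
    and t0_pos: "t0 > 0"
    and r_ge: "r \<ge> 2"
    and traj: "trajectory S X Y \<psi> \<phi> r t0 x l u c y m v n"
    and saddle: "saddle_point S (block_product X) (block_product Y) xs ls ys ms"
  shows "((\<lambda>t. S (x t) ls ys (m t) - S xs (l t) (y t) ms) \<longlongrightarrow> 0) at_top \<and>
         (\<lambda>t. S (x t) ls ys (m t) - S xs (l t) (y t) ms) \<in> O(\<lambda>t. 1 / t\<^sup>2) \<and>
         ((\<lambda>t. (x t, y t)) \<longlongrightarrow> (xs, ys)) at_top"
proof -
  define L1 where "L1 = (kron_id_mult (laplacian w1) :: (real ^ 'p1) ^ 'n1 \<Rightarrow> _)"
  define L2 where "L2 = (kron_id_mult (laplacian w2) :: (real ^ 'p2) ^ 'n2 \<Rightarrow> _)"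
  define B where "B = coupling H"
  define B' where "B' = coupling (\<lambda>j i. transpose (H i j))"
  have L1: "linear L1" "\<And>a b. a \<bullet> L1 b = b \<bullet> L1 a" "\<And>a. 0 \<le> a \<bullet> L1 a"
    unfolding L1_def by (rule linear_kron_id_mult laplacian_symmetric[OF graph1] laplacian_nonneg[OF graph1])+
  have L2: "linear L2" "\<And>a b. a \<bullet> L2 b = b \<bullet> L2 a" "\<And>a. 0 \<le> a \<bullet> L2 a"
    unfolding L2_def by (rule linear_kron_id_mult laplacian_symmetric[OF graph2] laplacian_nonneg[OF graph2])+
  have S_min: "S x l y m = block_cost f (B y + L1 l) L1 x - block_cost g (L2 m) L2 y" for x l y m
    unfolding S_eq U_eq B_def L1_def L2_def by (rule lagrangian_as_min_cost[OF graph1 graph2])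
  have S_max: "S x l y m = block_cost f (L1 l) L1 x - block_cost g (- B' x + L2 m) L2 y" for x l y m
    unfolding S_eq U_eq B'_def L1_def L2_def by (rule lagrangian_as_max_cost[OF graph1 graph2])

  have in_C: "xs \<in> block_product X" "ys \<in> block_product Y"
    and max_y: "\<And>y l. y \<in> block_product Y \<Longrightarrow> S xs l y ms \<le> S xs ls ys ms"
    and min_x: "\<And>x m. x \<in> block_product X \<Longrightarrow> S xs ls ys ms \<le> S x ls ys m"
    using saddle unfolding saddle_point_def by blast+
  \<comment> \<open>Otherwise moving the multiplier along \<open>L1 xs\<close> would increase the Lagrangian.\<close>
  have L1_xs: "L1 xs = 0"
  proof -
    have "L1 xs \<bullet> L1 xs \<le> 0"
      using max_y[OF in_C(2), of "ls + L1 xs"] L1(2)[of xs "L1 xs"]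
      by (simp add: S_max block_cost_def linear_add[OF L1(1)] inner_add_right)
    then show ?thesis by (metis inner_eq_zero_iff inner_ge_zero order_antisym)
  qed
  have L2_ys: "L2 ys = 0"
  proof -
    have "L2 ys \<bullet> L2 ys \<le> 0"
      using min_x[OF in_C(1), of "ms + L2 ys"] L2(2)[of ys "L2 ys"]
      by (simp add: S_min block_cost_def linear_add[OF L2(1)] inner_add_right)
    then show ?thesis by (metis inner_eq_zero_iff inner_ge_zero order_antisym)
  qed
  have min_1: "block_cost f (B ys + L1 ls) L1 xs \<le> block_cost f (B ys + L1 ls) L1 w"
    if "w \<in> block_product X" for w
    using min_x[OF that, of ms] by (simp add: S_min)
  have min_2: "block_cost g (- B' xs + L2 ms) L2 ys \<le> block_cost g (- B' xs + L2 ms) L2 w"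
    if "w \<in> block_product Y" for w
    using max_y[OF that, of ls] by (simp add: S_max)

  let ?p = "\<lambda>t. mirror_map X \<psi> (u t)" and ?q = "\<lambda>t. mirror_map Y \<phi> (v t)"
  have "r > 0" using r_ge by simp
  note step = traj[unfolded trajectory_def, THEN conjunct1, rule_format]
  have xd: "(x has_vector_derivative (r / t) *\<^sub>R (?p t - x t)) (at t within {t0..})"
    and ld: "(l has_vector_derivative (r / t) *\<^sub>R (c t - l t)) (at t within {t0..})"
    and yd: "(y has_vector_derivative (r / t) *\<^sub>R (?q t - y t)) (at t within {t0..})"
    and md: "(m has_vector_derivative (r / t) *\<^sub>R (n t - m t)) (at t within {t0..})"
    if t: "t \<ge> t0" for t
    by (rule has_vector_derivative_blocks, use step[OF t] in \<open>simp add: mirror_map_def\<close>)+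
  note extrapolated = extrapolated_state[OF t0_pos \<open>r > 0\<close>]
  have "\<exists>F. (\<forall>i. has_gradient_within (f i) (F $ i) (x t $ i) (X i)) \<and>
      (u has_vector_derivative - ((t / r) *\<^sub>R (F + (B (?q t) + L1 (c t)) + L1 (x t)))) (at t within {t0..})"
    if t: "t \<ge> t0" for t
  proof (rule block_gradient_flow_cost[OF L1(1,2), where k = "- block_cost g (L2 (m t)) L2 (?q t)"])
    fix i
    show "\<exists>D. has_block_gradient (\<lambda>w. block_cost f (B (?q t) + L1 (c t)) L1 w
          + - block_cost g (L2 (m t)) L2 (?q t)) i (X i) (x t) D \<and>
        ((\<lambda>s. u s $ i) has_vector_derivative - ((t / r) *\<^sub>R D)) (at t within {t0..})"
      using step[OF t, THEN conjunct1, THEN spec[of _ i]]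
      unfolding extrapolated[OF t ld[OF t]] extrapolated[OF t yd[OF t]] S_min by simp
  qed
  then obtain F where F: "\<And>t i. t \<ge> t0 \<Longrightarrow> has_gradient_within (f i) (F t $ i) (x t $ i) (X i)"
    and ud: "\<And>t. t \<ge> t0 \<Longrightarrow> (u has_vector_derivative
      - ((t / r) *\<^sub>R (F t + (B (?q t) + L1 (c t)) + L1 (x t)))) (at t within {t0..})"
    by metis
  have "\<exists>G. (\<forall>j. has_gradient_within (g j) (G $ j) (y t $ j) (Y j)) \<and>
      (v has_vector_derivative - ((t / r) *\<^sub>R (G + (- B' (?p t) + L2 (n t)) + L2 (y t)))) (at t within {t0..})"
    if t: "t \<ge> t0" for t
  proof (rule block_gradient_flow_cost[OF L2(1,2), where k = "- block_cost f (L1 (l t)) L1 (?p t)"])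
    fix j
    obtain D where D: "has_block_gradient (\<lambda>w. S (?p t) (l t) w (n t)) j (Y j) (y t) D"
      and vD: "((\<lambda>s. v s $ j) has_vector_derivative (t / r) *\<^sub>R D) (at t within {t0..})"
      using step[OF t, THEN conjunct2, THEN spec[of _ j]]
      unfolding extrapolated[OF t xd[OF t]] extrapolated[OF t md[OF t]] by blast
    \<comment> \<open>The maximizer ascends the Lagrangian, that is, descends its own cost.\<close>
    from block_gradient_uminus[OF D] vD
    show "\<exists>D. has_block_gradient (\<lambda>w. block_cost g (- B' (?p t) + L2 (n t)) L2 w
          + - block_cost f (L1 (l t)) L1 (?p t)) j (Y j) (y t) D \<and>
        ((\<lambda>s. v s $ j) has_vector_derivative - ((t / r) *\<^sub>R D)) (at t within {t0..})"
      by (intro exI[of _ "- D"]) (simp add: S_max)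
  qed
  then obtain G where G: "\<And>t j. t \<ge> t0 \<Longrightarrow> has_gradient_within (g j) (G t $ j) (y t $ j) (Y j)"
    and vd: "\<And>t. t \<ge> t0 \<Longrightarrow> (v has_vector_derivative
      - ((t / r) *\<^sub>R (G t + (- B' (?p t) + L2 (n t)) + L2 (y t)))) (at t within {t0..})"
    by metis
  have cd: "(c has_vector_derivative (t / r) *\<^sub>R L1 (?p t)) (at t within {t0..})" if t: "t \<ge> t0" for t
  proof (rule block_gradient_flow_linear[where
        k = "block_cost f (B (y t)) L1 (?p t) - block_cost g (L2 (m t)) L2 (y t)"
        and z = "l t"])
    fix i
    have "S (?p t) w (y t) (m t) = w \<bullet> L1 (?p t)
        + (block_cost f (B (y t)) L1 (?p t) - block_cost g (L2 (m t)) L2 (y t))" for w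
      using L1(2)[of "?p t" w] by (simp add: S_min block_cost_def inner_add_right)
    then show "\<exists>D. has_block_gradient (\<lambda>w. w \<bullet> L1 (?p t)
          + (block_cost f (B (y t)) L1 (?p t) - block_cost g (L2 (m t)) L2 (y t))) i UNIV (l t) D \<and>
        ((\<lambda>s. c s $ i) has_vector_derivative (t / r) *\<^sub>R D) (at t within {t0..})"
      using step[OF t, THEN conjunct1, THEN spec[of _ i]]
      unfolding extrapolated[OF t xd[OF t]] by simp
  qed
  have nd: "(n has_vector_derivative (t / r) *\<^sub>R L2 (?q t)) (at t within {t0..})" if t: "t \<ge> t0" for t
  proof (rule block_gradient_flow_linear[where
        k = "block_cost g 0 L2 (?q t) - block_cost f (B (?q t) + L1 (l t)) L1 (x t)"
        and z = "m t"])
    fix j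
    obtain D where D: "has_block_gradient (\<lambda>w. S (x t) (l t) (?q t) w) j UNIV (m t) D"
      and nD: "((\<lambda>s. n s $ j) has_vector_derivative - ((t / r) *\<^sub>R D)) (at t within {t0..})"
      using step[OF t, THEN conjunct2, THEN spec[of _ j]]
      unfolding extrapolated[OF t yd[OF t]] by blast
    have "- S (x t) (l t) (?q t) w = w \<bullet> L2 (?q t)
        + (block_cost g 0 L2 (?q t) - block_cost f (B (?q t) + L1 (l t)) L1 (x t))" for w
      using L2(2)[of "?q t" w] by (simp add: S_min block_cost_def inner_add_right)
    with block_gradient_uminus[OF D] nD
    show "\<exists>D. has_block_gradient (\<lambda>w. w \<bullet> L2 (?q t)
          + (block_cost g 0 L2 (?q t) - block_cost f (B (?q t) + L1 (l t)) L1 (x t))) j UNIV (m t) D \<and>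
        ((\<lambda>s. n s $ j) has_vector_derivative (t / r) *\<^sub>R D) (at t within {t0..})"
      by (intro exI[of _ "- D"]) simp
  qed

  interpret P: player X f \<psi> L1 r t0 x u c F "\<lambda>t. B (?q t)" xs ls "B ys"
  proof (rule player.intro)
    show "linear L1" by (rule L1)
    show "continuous_on (X i) (f i)" for i using A1_f continuous_on_C1 by blast
    show "x t0 = ?p t0"
      using traj by (simp add: trajectory_def mirror_map_def vec_eq_iff)
    show "(u has_vector_derivative - ((t / r) *\<^sub>R (F t + B (?q t) + L1 (c t) + L1 (x t)))) (at t within {t0..})"
      if "t \<ge> t0" for t
      using ud[OF that] by (simp only: add.assoc)
    show "block_cost f (B ys + L1 ls) L1 xs \<le> block_cost f (B ys + L1 ls) L1 w"
      if "w \<in> block_product X" for w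
      by (rule min_1[OF that])
  qed (use X_closed_convex A1_f A2_psi L1(2,3) t0_pos r_ge xd cd F in_C(1) L1_xs in auto)
  interpret Q: player Y g \<phi> L2 r t0 y v n G "\<lambda>t. - B' (?p t)" ys ms "- B' xs"
  proof (rule player.intro)
    show "linear L2" by (rule L2)
    show "continuous_on (Y j) (g j)" for j using A1_g continuous_on_C1 by blast
    show "y t0 = ?q t0"
      using traj by (simp add: trajectory_def mirror_map_def vec_eq_iff)
    show "(v has_vector_derivative - ((t / r) *\<^sub>R (G t + - B' (?p t) + L2 (n t) + L2 (y t)))) (at t within {t0..})"
      if "t \<ge> t0" for t
      using vd[OF that] by (simp only: add.assoc)
    show "block_cost g (- B' xs + L2 ms) L2 ys \<le> block_cost g (- B' xs + L2 ms) L2 w"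
      if "w \<in> block_product Y" for w
      by (rule min_2[OF that])
  qed (use Y_closed_convex A1_g A2_phi L2(2,3) t0_pos r_ge yd nd G in_C(2) L2_ys in auto)

  define gx where "gx t = P.\<Phi> (x t) - P.\<Phi> xs" for t
  define gy where "gy t = Q.\<Phi> (y t) - Q.\<Phi> ys" for t
  have gap: "S (x t) ls ys (m t) - S xs (l t) (y t) ms = gx t + gy t" for t
  proof -
    have "S (x t) ls ys (m t) = S (x t) ls ys ms"
      using L2(2)[of ys] by (simp add: S_min block_cost_def L2_ys)
    moreover have "S xs (l t) (y t) ms = S xs ls (y t) ms"
      using L1(2)[of xs] by (simp add: S_max block_cost_def L1_xs)
    moreover have "S (x t) ls ys ms - S xs ls ys ms = gx t"
      by (simp add: S_min gx_def)
    moreover have "S xs ls ys ms - S xs ls (y t) ms = gy t"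
      by (simp add: S_max gy_def)
    ultimately show ?thesis by linarith
  qed
  define K where "K = r\<^sup>2 * (P.energy t0 + Q.energy t0)"
  have gap_le: "gx t + gy t \<le> K * (1 / t\<^sup>2)" if t: "t \<ge> t0" for t
  proof -
    have "P.energy t + Q.energy t \<le> P.energy t0 + Q.energy t0"
    proof (rule nonincreasing_on_ray[OF _ t])
      fix t assume t: "t0 \<le> t"
      obtain D1 where D1: "D1 \<le> - ((t / r) * ((?p t - xs) \<bullet> (B (?q t) - B ys)))"
        "(P.energy has_real_derivative D1) (at t within {t0..})"
        using P.energy_deriv[OF t] by blast
      obtain D2 where D2: "D2 \<le> - ((t / r) * ((?q t - ys) \<bullet> (- B' (?p t) - - B' xs)))"
        "(Q.energy has_real_derivative D2) (at t within {t0..})"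
        using Q.energy_deriv[OF t] by blast
      \<comment> \<open>The exchange terms are opposite, since \<open>B'\<close> is the adjoint of \<open>B\<close>.\<close>
      have "(?q t - ys) \<bullet> (- B' (?p t) - - B' xs) = - ((?q t - ys) \<bullet> B' (?p t - xs))"
        by (simp add: B'_def coupling_diff inner_diff_right)
      also have "\<dots> = - ((?p t - xs) \<bullet> (B (?q t) - B ys))"
        unfolding B_def B'_def coupling_adjoint by (simp only: coupling_diff)
      finally have "D1 + D2 \<le> 0" using D1(1) D2(1) by simp
      with DERIV_add[OF D1(2) D2(2)]
      show "\<exists>D\<le>0. ((\<lambda>t. P.energy t + Q.energy t) has_real_derivative D) (at t within {t0..})"
        by blast
    qed
    moreover have "(t / r)\<^sup>2 * (gx t + gy t) \<le> P.energy t + Q.energy t"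
      using P.cost_gap_le_energy[OF t] Q.cost_gap_le_energy[OF t]
      by (simp add: gx_def gy_def distrib_left)
    ultimately have "(t / r)\<^sup>2 * (gx t + gy t) \<le> P.energy t0 + Q.energy t0" by linarith
    then show ?thesis
      using \<open>r > 0\<close> t t0_pos by (simp add: K_def field_simps)
  qed
  have nonneg: "0 \<le> gx t" "0 \<le> gy t" if "t \<ge> t0" for t
    using P.cost_gap_nonneg[OF that] Q.cost_gap_nonneg[OF that] by (simp_all add: gx_def gy_def)
  have ev: "\<forall>\<^sub>F t in at_top. t \<ge> t0" by (rule eventually_ge_at_top)
  have bound_lim: "((\<lambda>t::real. K * (1 / t\<^sup>2)) \<longlongrightarrow> 0) at_top"
    by (intro tendsto_mult_right_zero tendsto_divide_0[OF tendsto_const]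
        filterlim_at_top_imp_at_infinity filterlim_pow_at_top filterlim_ident) simp
  have squeeze: "(h \<longlongrightarrow> 0) at_top" if "\<And>t. t \<ge> t0 \<Longrightarrow> 0 \<le> h t \<and> h t \<le> gx t + gy t" for h
  proof (rule tendsto_sandwich[OF _ _ tendsto_const bound_lim])
    show "\<forall>\<^sub>F t in at_top. 0 \<le> h t" using ev by eventually_elim (use that in blast)
    show "\<forall>\<^sub>F t in at_top. h t \<le> K * (1 / t\<^sup>2)"
      using ev by eventually_elim (use that gap_le in \<open>meson order_trans\<close>)
  qed
  have "((\<lambda>t. gx t + gy t) \<longlongrightarrow> 0) at_top"
    by (rule squeeze) (use nonneg in fastforce)
  moreover have "(\<lambda>t. gx t + gy t) \<in> O(\<lambda>t. 1 / t\<^sup>2)"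
  proof (rule bigoI[of _ K])
    show "\<forall>\<^sub>F t in at_top. norm (gx t + gy t) \<le> K * norm (1 / t\<^sup>2)"
      using ev by eventually_elim (use gap_le nonneg in \<open>simp add: add_nonneg_nonneg\<close>)
  qed
  moreover have "(x \<longlongrightarrow> xs) at_top"
    by (rule P.converges_if_cost_converges, fold gx_def, rule squeeze) (use nonneg in fastforce)
  moreover have "(y \<longlongrightarrow> ys) at_top"
    by (rule Q.converges_if_cost_converges, fold gy_def, rule squeeze) (use nonneg in fastforce)
  ultimately show ?thesis
    unfolding gap by (intro conjI tendsto_Pair)
qed

end
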